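(* Let $(\mathcal{F}_q(G),* )$ be a real quantum group. (a) Let $\mathcal{F}_q(K)$ be a real coisotropic quantum left subgroup of $\mathcal{F}_q(G)$ with projection $\pi$, let $\rho_R$ be a unitary right corepresentation of $\mathcal{F}_q(K)$ on $V$, and let $\langle\,,\rangle_L$ be the sesquilinear map from $V\otimes\mathcal{F}_q(G)$ to $\mathcal{F}_q(G)$ given by $\langle v\otimes a,w\otimes b\rangle_L=\langle v,w\rangle\,a^*b$. If $A,B\in\mathrm{ind}_K^G(\rho_R)$, then $\langle A,B\rangle_L\in B_\pi$. (b) Let $\mathcal{F}_q(K)$ be a real coisotropic quantum right subgroup of $\mathcal{F}_q(G)$ with projection $\pi$, let $\rho_L$ be a unitary left corepresentation of $\mathcal{F}_q(K)$ on $V$, and let $\langle\,,\rangle_R$ be the sesquilinear map from $\mathcal{F}_q(G)\otimes V$ to $\mathcal{F}_q(G)$ given by $\langle a\otimes v,b\otimes w\rangle_R=\langle v,w\rangle\,ba^*$. If $A,B\in\mathrm{ind}_K^G(\rho_L)$, then $\langle A,B\rangle_R\in B^\pi$.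
   Context: A real quantum group $(\mathcal{F}_q(G),* )$ is a Hopf $*$-algebra over $\mathbb{C}$ with coproduct $\Delta$, antipode $S$; $\tau=*\circ S$, i.e. $\tau(a)=S(a)^*$, and $\tau^2=\mathrm{id}$. A real coisotropic quantum right (resp. left) subgroup $(\mathcal{F}_q(K),\tau_K)$ is a coalgebra and right (resp. left) $\mathcal{F}_q(G)$-module with a surjective linear map $\pi:\mathcal{F}_q(G)\to\mathcal{F}_q(K)$ that is a morphism of coalgebras and of right (resp. left) $\mathcal{F}_q(G)$-modules ($\mathcal{F}_q(G)$ acting on itself by multiplication), and with an antilinear map $\tau_K:\mathcal{F}_q(K)\to\mathcal{F}_q(K)$ such that $\tau_K\circ\pi=\pi\circ\tau$. In the left case put $B_\pi=\{a\in\mathcal{F}_q(G):(\pi\otimes\mathrm{id})\Delta a=\pi(1)\otimes a\}$; in the right case put $B^\pi=\{a\in\mathcal{F}_q(G):(\mathrm{id}\otimes\pi)\Delta a=a\otimes\pi(1)\}$. $V$ is a complex vector space with scalar product $\langle\,,\rangle$ (antilinear in the first argument, linear in the second) and orthonormal basis $\{e_i\}$; sums over the basis are finite. A right corepresentation $\rho_R:V\to V\otimes\mathcal{F}_q(K)$ is written $\rho_R(e_i)=\sum_je_j\otimes a_{ji}$, and is unitary if $\tau_K(a_{ij})=a_{ji}$ for all $i,j$. A left corepresentation $\rho_L:V\to\mathcal{F}_q(K)\otimes V$ is written $\rho_L(e_i)=\sum_jb_{ij}\otimes e_j$, and is unitary if $\tau_K(b_{ij})=b_{ji}$ for all $i,j$.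 Let $L=(\pi\otimes\mathrm{id})\Delta$ and $R=(\mathrm{id}\otimes\pi)\Delta$. Then $$\mathrm{ind}_K^G(\rho_R)=\{F\in V\otimes\mathcal{F}_q(G):(\mathrm{id}\otimes L)F=(\rho_R\otimes\mathrm{id})F\},$$ $$\mathrm{ind}_K^G(\rho_L)=\{F\in\mathcal{F}_q(G)\otimes V:(R\otimes\mathrm{id})F=(\mathrm{id}\otimes\rho_L)F\}.$$ *)

theory Defs
  imports Complex_Main "HOL-Library.Poly_Mapping"
begin

section \<open>Complex vector spaces and algebras\<close>

class complex_space = ab_group_add +
  fixes cscale :: "complex \<Rightarrow> 'a \<Rightarrow> 'a"  (infixr "*\<^sub>C" 75)
  assumes cscale_add_right: "c *\<^sub>C (x + y) = c *\<^sub>C x + c *\<^sub>C y"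
    and cscale_add_left: "(c + d) *\<^sub>C x = c *\<^sub>C x + d *\<^sub>C x"
    and cscale_cscale: "c *\<^sub>C d *\<^sub>C x = (c * d) *\<^sub>C x"
    and cscale_one: "1 *\<^sub>C x = x"

global_interpretation complex_space: vector_space "cscale :: complex \<Rightarrow> 'a \<Rightarrow> 'a::complex_space"
  by unfold_locales
    (simp_all add: cscale_add_right cscale_add_left cscale_cscale cscale_one)

class complex_alg = complex_space + ring_1 +
  assumes cscale_mult_left: "(c *\<^sub>C x) * y = c *\<^sub>C (x * y)"
    and cscale_mult_right: "x * (c *\<^sub>C y) = c *\<^sub>C (x * y)"

abbreviation clinear :: "('a::complex_space \<Rightarrow> 'b::complex_space) \<Rightarrow> bool" where
  "clinear \<equiv> Vector_Spaces.linear cscale cscale"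

abbreviation cfunctional :: "('a::complex_space \<Rightarrow> complex) \<Rightarrow> bool" where
  "cfunctional \<equiv> Vector_Spaces.linear cscale (*)"

definition cantilinear :: "('a::complex_space \<Rightarrow> 'b::complex_space) \<Rightarrow> bool" where
  "cantilinear f \<longleftrightarrow>
     (\<forall>x y. f (x + y) = f x + f y) \<and> (\<forall>c x. f (c *\<^sub>C x) = cnj c *\<^sub>C f x)"


section \<open>The algebraic tensor product\<close>

text \<open>The quotient of the free complex vector space on \<open>'a \<times> 'b\<close> by the subspace generated by
  the bilinearity relations. The coefficient \<open>c\<close> in the generators makes the additive closure
  below a linear subspace.\<close>

inductive tensor_null :: "('a::complex_space \<times> 'b::complex_space \<Rightarrow>\<^sub>0 complex) \<Rightarrow> bool" where
  zero: "tensor_null 0"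
| add: "tensor_null p \<Longrightarrow> tensor_null q \<Longrightarrow> tensor_null (p + q)"
| add_left: "tensor_null (Poly_Mapping.single (x + x', y) c
     - Poly_Mapping.single (x, y) c - Poly_Mapping.single (x', y) c)"
| add_right: "tensor_null (Poly_Mapping.single (x, y + y') c
     - Poly_Mapping.single (x, y) c - Poly_Mapping.single (x, y') c)"
| scale_left: "tensor_null (Poly_Mapping.single (k *\<^sub>C x, y) c - Poly_Mapping.single (x, y) (c * k))"
| scale_right: "tensor_null (Poly_Mapping.single (x, k *\<^sub>C y) c - Poly_Mapping.single (x, y) (c * k))"

lemma lookup_map_times:
  "Poly_Mapping.lookup (Poly_Mapping.map ((*) (k::complex)) p) z = k * Poly_Mapping.lookup p z"
  by (simp add: Poly_Mapping.map.rep_eq when_def)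

lemma map_times_add:
  "Poly_Mapping.map ((*) (k::complex)) (p + q)
   = Poly_Mapping.map ((*) k) p + Poly_Mapping.map ((*) k) q"
  by (rule poly_mapping_eqI) (simp add: lookup_map_times lookup_add algebra_simps)

lemma map_times_diff:
  "Poly_Mapping.map ((*) (k::complex)) (p - q)
   = Poly_Mapping.map ((*) k) p - Poly_Mapping.map ((*) k) q"
  by (rule poly_mapping_eqI) (simp add: lookup_map_times lookup_minus algebra_simps)

lemma map_times_single:
  "Poly_Mapping.map ((*) (k::complex)) (Poly_Mapping.single z c) = Poly_Mapping.single z (k * c)"
  by (rule poly_mapping_eqI) (simp add: lookup_map_times lookup_single when_def)

lemma tensor_null_scale:
  "tensor_null p \<Longrightarrow> tensor_null (Poly_Mapping.map ((*) k) p)"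
proof (induction rule: tensor_null.induct)
  case zero
  have "Poly_Mapping.map ((*) k) (0 :: 'a \<times> 'b \<Rightarrow>\<^sub>0 complex) = 0"
    by (rule poly_mapping_eqI) (simp add: lookup_map_times)
  then show ?case by (simp add: tensor_null.zero)
qed (simp_all add: map_times_add map_times_diff map_times_single tensor_null.intros mult.assoc[symmetric])

lemma tensor_null_uminus: "tensor_null p \<Longrightarrow> tensor_null (- p)"
proof -
  assume "tensor_null p"
  then have "tensor_null (Poly_Mapping.map ((*) (-1)) p)" by (rule tensor_null_scale)
  moreover have "Poly_Mapping.map ((*) (-1)) p = - p"
    by (rule poly_mapping_eqI) (simp add: lookup_map_times)
  ultimately show ?thesis by simp
qed

definition tensor_rel ::
  "('a::complex_space \<times> 'b::complex_space \<Rightarrow>\<^sub>0 complex) \<Rightarrow> ('a \<times> 'b \<Rightarrow>\<^sub>0 complex) \<Rightarrow> bool" where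
  "tensor_rel p q \<longleftrightarrow> tensor_null (p - q)"

quotient_type (overloaded) ('a, 'b) tensor =
  "('a::complex_space \<times> 'b::complex_space) \<Rightarrow>\<^sub>0 complex" / tensor_rel
proof (rule equivpI)
  show "reflp (tensor_rel :: ('a \<times> 'b \<Rightarrow>\<^sub>0 complex) \<Rightarrow> _)"
    by (simp add: reflp_def tensor_rel_def tensor_null.zero)
  show "symp (tensor_rel :: ('a \<times> 'b \<Rightarrow>\<^sub>0 complex) \<Rightarrow> _)"
    unfolding symp_def tensor_rel_def using tensor_null_uminus by fastforce
  show "transp (tensor_rel :: ('a \<times> 'b \<Rightarrow>\<^sub>0 complex) \<Rightarrow> _)"
  proof (rule transpI)
    fix p q r :: "'a \<times> 'b \<Rightarrow>\<^sub>0 complex"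
    assume "tensor_rel p q" "tensor_rel q r"
    then have "tensor_null ((p - q) + (q - r))"
      unfolding tensor_rel_def by (rule tensor_null.add)
    then show "tensor_rel p r" by (simp add: tensor_rel_def)
  qed
qed

instantiation tensor :: (complex_space, complex_space) complex_space
begin

lift_definition zero_tensor :: "('a, 'b) tensor" is 0 .

lift_definition plus_tensor :: "('a, 'b) tensor \<Rightarrow> ('a, 'b) tensor \<Rightarrow> ('a, 'b) tensor" is "(+)"
  unfolding tensor_rel_def using tensor_null.add by (fastforce simp: algebra_simps)

lift_definition uminus_tensor :: "('a, 'b) tensor \<Rightarrow> ('a, 'b) tensor" is uminus
  unfolding tensor_rel_def using tensor_null_uminus by fastforce

lift_definition minus_tensor :: "('a, 'b) tensor \<Rightarrow> ('a, 'b) tensor \<Rightarrow> ('a, 'b) tensor" is "(-)"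
proof -
  fix p p' q q' :: "'a \<times> 'b \<Rightarrow>\<^sub>0 complex"
  assume "tensor_rel p p'" "tensor_rel q q'"
  then have "tensor_null ((p - p') + - (q - q'))"
    unfolding tensor_rel_def by (intro tensor_null.add tensor_null_uminus)
  then show "tensor_rel (p - q) (p' - q')" by (simp add: tensor_rel_def algebra_simps)
qed

lift_definition cscale_tensor :: "complex \<Rightarrow> ('a, 'b) tensor \<Rightarrow> ('a, 'b) tensor"
  is "\<lambda>c. Poly_Mapping.map ((*) c)"
  unfolding tensor_rel_def using tensor_null_scale by (metis map_times_diff)

instance
proof
  fix s t u :: "('a, 'b) tensor" and c d :: complex
  have refl: "tensor_rel p q" if "p = q" for p q :: "'a \<times> 'b \<Rightarrow>\<^sub>0 complex"
    using that by (simp add: tensor_rel_def tensor_null.zero)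
  show "s + t + u = s + (t + u)" by transfer (rule refl, simp add: algebra_simps)
  show "s + t = t + s" by transfer (rule refl, simp add: algebra_simps)
  show "0 + s = s" by transfer (rule refl, simp)
  show "- s + s = 0" by transfer (rule refl, simp)
  show "s - t = s + - t" by transfer (rule refl, simp)
  show "c *\<^sub>C (s + t) = c *\<^sub>C s + c *\<^sub>C t" by transfer (rule refl, rule map_times_add)
  show "(c + d) *\<^sub>C s = c *\<^sub>C s + d *\<^sub>C s"
    by transfer (rule refl, rule poly_mapping_eqI, simp add: lookup_map_times lookup_add algebra_simps)
  show "c *\<^sub>C d *\<^sub>C s = (c * d) *\<^sub>C s"
    by transfer (rule refl, rule poly_mapping_eqI, simp add: lookup_map_times)
  show "1 *\<^sub>C s = s"
    by transfer (rule refl, rule poly_mapping_eqI, simp add: lookup_map_times)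
qed

end

lift_definition pure_tensor ::
  "'a::complex_space \<Rightarrow> 'b::complex_space \<Rightarrow> ('a, 'b) tensor"  (infixr "\<otimes>" 73)
  is "\<lambda>x y. Poly_Mapping.single (x, y) 1" .

lemma pure_tensor_add_left: "(x + x') \<otimes> y = x \<otimes> y + x' \<otimes> y"
  by transfer (use tensor_null.add_left in \<open>simp add: tensor_rel_def diff_diff_eq[symmetric]\<close>)

lemma pure_tensor_add_right: "x \<otimes> (y + y') = x \<otimes> y + x \<otimes> y'"
  by transfer (use tensor_null.add_right in \<open>simp add: tensor_rel_def diff_diff_eq[symmetric]\<close>)

lemma pure_tensor_scale_left: "(c *\<^sub>C x) \<otimes> y = c *\<^sub>C (x \<otimes> y)"
  by transfer (use tensor_null.scale_left[where c = 1] in \<open>simp add: tensor_rel_def map_times_single\<close>)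

lemma pure_tensor_scale_right: "x \<otimes> (c *\<^sub>C y) = c *\<^sub>C (x \<otimes> y)"
  by transfer (use tensor_null.scale_right[where c = 1] in \<open>simp add: tensor_rel_def map_times_single\<close>)

lemma poly_mapping_single_induct [case_names zero add]:
  assumes "P 0" and "\<And>p z c. P p \<Longrightarrow> P (p + Poly_Mapping.single z (c::complex))"
  shows "P p"
proof (induction p rule: update_induct)
  case const
  then show ?case by (simp add: assms(1))
next
  case (update p z c)
  have "Poly_Mapping.update z c p = p + Poly_Mapping.single z c"
    using update(1)
    by (intro poly_mapping_eqI)
      (auto simp: lookup_update lookup_add lookup_single when_def in_keys_iff)
  then show ?case using assms(2) update by simp
qed

lemma tensor_induct [case_names zero add]:
  assumes "P 0" and "\<And>t x y. P t \<Longrightarrow> P (t + x \<otimes> y)"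
  shows "P (t :: ('a::complex_space, 'b::complex_space) tensor)"
proof -
  have "P (abs_tensor p)" for p
  proof (induction p rule: poly_mapping_single_induct)
    case zero
    then show ?case using assms(1) by (simp add: zero_tensor_def)
  next
    case (add p z c)
    obtain x y where z: "z = (x, y)" by (cases z)
    have "abs_tensor (Poly_Mapping.single z c) = c *\<^sub>C (x \<otimes> y)"
      by (simp add: z pure_tensor.abs_eq cscale_tensor.abs_eq map_times_single)
    then have "abs_tensor (p + Poly_Mapping.single z c) = abs_tensor p + (c *\<^sub>C x) \<otimes> y"
      by (simp add: plus_tensor.abs_eq[symmetric] pure_tensor_scale_left)
    then show ?case using assms(2) add by simp
  qed
  then show ?thesis by (induct t rule: tensor.abs_induct) blast
qed

subsection \<open>Maps out of a tensor product\<close>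

text \<open>\<open>tensor_lift f (\<Sum> x \<otimes> y) = \<Sum> f x y\<close>. Besides bilinear maps this also has to handle
  maps that are antilinear in both variables, so well-definedness is required only for
  biadditive maps that allow scalars to be moved from one argument to the other.\<close>

definition balanced :: "('a::complex_space \<Rightarrow> 'b::complex_space \<Rightarrow> 'c::ab_group_add) \<Rightarrow> bool" where
  "balanced f \<longleftrightarrow> (\<forall>x x' y. f (x + x') y = f x y + f x' y) \<and>
     (\<forall>x y y'. f x (y + y') = f x y + f x y') \<and> (\<forall>c x y. f (c *\<^sub>C x) y = f x (c *\<^sub>C y))"

definition free_lift :: "('a::complex_space \<Rightarrow> 'b::complex_space \<Rightarrow> 'c::ab_group_add)
    \<Rightarrow> ('a \<times> 'b \<Rightarrow>\<^sub>0 complex) \<Rightarrow> 'c" where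
  "free_lift f p = (\<Sum>(x, y) \<in> Poly_Mapping.keys p. f (Poly_Mapping.lookup p (x, y) *\<^sub>C x) y)"

definition tensor_lift :: "('a::complex_space \<Rightarrow> 'b::complex_space \<Rightarrow> 'c::ab_group_add)
    \<Rightarrow> ('a, 'b) tensor \<Rightarrow> 'c" where
  "tensor_lift f t = free_lift f (rep_tensor t)"

lemma tensor_lift_fun_add:
  "tensor_lift (\<lambda>x y. f x y + g x y) t = tensor_lift f t + tensor_lift g t"
  by (simp add: tensor_lift_def free_lift_def case_prod_unfold sum.distrib)

lemma tensor_lift_fun_scale:
  "tensor_lift (\<lambda>x y. c *\<^sub>C f x y) t = c *\<^sub>C tensor_lift f t"
  by (simp add: tensor_lift_def free_lift_def case_prod_unfold complex_space.scale_sum_right)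

lemma balancedD:
  assumes "balanced f"
  shows "f (x + x') y = f x y + f x' y" "f x (y + y') = f x y + f x y'"
    "f (c *\<^sub>C x) y = f x (c *\<^sub>C y)" "f 0 y = 0" "f x 0 = 0"
proof -
  show *: "f (x + x') y = f x y + f x' y" "f x (y + y') = f x y + f x y'"
    "f (c *\<^sub>C x) y = f x (c *\<^sub>C y)" for x x' y y' c
    using assms by (auto simp: balanced_def)
  show "f 0 y = 0" "f x 0 = 0" using *(1)[of 0 0 y] *(2)[of x 0 0] by auto
qed

lemma free_lift_superset:
  assumes "balanced f" "finite A" "Poly_Mapping.keys p \<subseteq> A"
  shows "free_lift f p = (\<Sum>(x, y) \<in> A. f (Poly_Mapping.lookup p (x, y) *\<^sub>C x) y)"
  unfolding free_lift_def using assms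
  by (intro sum.mono_neutral_left) (auto simp: in_keys_iff balancedD(4)[OF assms(1)])

lemma free_lift_add:
  assumes "balanced f"
  shows "free_lift f (p + q) = free_lift f p + free_lift f q"
proof -
  let ?A = "Poly_Mapping.keys p \<union> Poly_Mapping.keys q"
  have "free_lift f r = (\<Sum>(x, y) \<in> ?A. f (Poly_Mapping.lookup r (x, y) *\<^sub>C x) y)"
    if "r \<in> {p, q, p + q}" for r
    using that Poly_Mapping.keys_add[of p q] by (intro free_lift_superset assms) auto
  then show ?thesis
    by (simp add: sum.distrib[symmetric] lookup_add cscale_add_left balancedD(1)[OF assms]
        case_prod_unfold)
qed

lemma free_lift_single:
  "balanced f \<Longrightarrow> free_lift f (Poly_Mapping.single (x, y) c) = f (c *\<^sub>C x) y"
  by (subst free_lift_superset[where A = "{(x, y)}"]) auto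

lemma free_lift_diff:
  assumes "balanced f"
  shows "free_lift f (p - q) = free_lift f p - free_lift f q"
  using free_lift_add[OF assms, of "p - q" q] by simp

lemma free_lift_null:
  assumes "tensor_null p" "balanced f"
  shows "free_lift f p = 0"
  using assms(1)
proof (induction rule: tensor_null.induct)
  case zero
  then show ?case by (simp add: free_lift_def)
qed (simp_all add: free_lift_add free_lift_diff free_lift_single assms(2) balancedD[OF assms(2)]
    cscale_add_right cscale_cscale mult.commute)

lemma tensor_lift_abs:
  assumes "balanced f"
  shows "tensor_lift f (abs_tensor p) = free_lift f p"
proof -
  have "tensor_null (rep_tensor (abs_tensor p) - p)"
    using Quotient3_rep_abs[OF Quotient3_tensor, of p] tensor.abs_eq_iff
    by (simp add: tensor_rel_def tensor_null.zero)
  then show ?thesis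
    using free_lift_null[OF _ assms] free_lift_diff[OF assms]
    by (metis eq_iff_diff_eq_0 tensor_lift_def)
qed

lemma tensor_lift_pure: "balanced f \<Longrightarrow> tensor_lift f (x \<otimes> y) = f x y"
  by (simp add: pure_tensor.abs_eq tensor_lift_abs free_lift_single cscale_one)

lemma tensor_lift_add:
  assumes "balanced f"
  shows "tensor_lift f (s + t) = tensor_lift f s + tensor_lift f t"
proof -
  have "\<exists>p. u = abs_tensor p" for u :: "('a, 'b) tensor"
    by (induct u rule: tensor.abs_induct) blast
  then obtain p q where "s = abs_tensor p" "t = abs_tensor q" by blast
  then show ?thesis
    by (simp add: plus_tensor.abs_eq tensor_lift_abs free_lift_add assms)
qed

lemma tensor_lift_zero: "balanced f \<Longrightarrow> tensor_lift f 0 = 0"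
  using tensor_lift_add[of f 0 0] by simp

lemma tensor_lift_scale:
  assumes "balanced f" "\<And>x y. f (c *\<^sub>C x) y = d *\<^sub>C f x y"
  shows "tensor_lift f (c *\<^sub>C t) = d *\<^sub>C tensor_lift f t"
  by (induction t rule: tensor_induct)
    (simp_all add: tensor_lift_zero tensor_lift_add tensor_lift_pure assms cscale_add_right
      pure_tensor_scale_left[symmetric])

text \<open>The map \<open>f \<otimes> g\<close>; meaningful when \<open>f\<close>, \<open>g\<close> are both linear or both antilinear.\<close>

definition tensor_map :: "('a::complex_space \<Rightarrow> 'c::complex_space)
    \<Rightarrow> ('b::complex_space \<Rightarrow> 'd::complex_space) \<Rightarrow> ('a, 'b) tensor \<Rightarrow> ('c, 'd) tensor" where
  "tensor_map f g = tensor_lift (\<lambda>x y. f x \<otimes> g y)"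

definition tensor_assoc :: "(('a::complex_space, 'b::complex_space) tensor, 'c::complex_space) tensor
    \<Rightarrow> ('a, ('b, 'c) tensor) tensor" where
  "tensor_assoc = tensor_lift (\<lambda>t z. tensor_lift (\<lambda>x y. x \<otimes> y \<otimes> z) t)"

definition tensor_mult ::
  "('a::complex_alg, 'b::complex_alg) tensor \<Rightarrow> ('a, 'b) tensor \<Rightarrow> ('a, 'b) tensor" where
  "tensor_mult s t = tensor_lift (\<lambda>x y. tensor_lift (\<lambda>x' y'. (x * x') \<otimes> (y * y')) t) s"


lemma linear_plus: "Vector_Spaces.linear s1 s2 f \<Longrightarrow> f (x + y) = f x + f y"
  unfolding Vector_Spaces.linear_def by (blast intro: module_hom.add)

lemma linear_cscale: "Vector_Spaces.linear s1 s2 f \<Longrightarrow> f (s1 c x) = s2 c (f x)"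
  unfolding Vector_Spaces.linear_def by (blast intro: module_hom.scale)

lemma clinearI:
  assumes "\<And>x y. f (x + y) = f x + f y" "\<And>c x. f (c *\<^sub>C x) = c *\<^sub>C f x"
  shows "clinear f"
proof -
  have "module_hom_axioms cscale cscale f"
    using assms by (simp add: module_hom_axioms_def)
  then show ?thesis
    by (simp add: Vector_Spaces.linear_def module_hom_def complex_space.vector_space_axioms
        complex_space.module_axioms)
qed

lemma tensor_map_pure:
  assumes "clinear f \<and> clinear g \<or> cantilinear f \<and> cantilinear g"
  shows "tensor_map f g (x \<otimes> y) = f x \<otimes> g y"
proof -
  have "balanced (\<lambda>x y. f x \<otimes> g y)"
    using assms by (auto simp: balanced_def cantilinear_def linear_plus linear_cscale
        pure_tensor_add_left pure_tensor_add_right pure_tensor_scale_left pure_tensor_scale_right)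
  then show ?thesis by (simp add: tensor_map_def tensor_lift_pure)
qed

lemma tensor_assoc_pure:
  fixes x :: "'a::complex_space" and y :: "'b::complex_space" and z :: "'c::complex_space"
  shows "tensor_assoc ((x \<otimes> y) \<otimes> z) = x \<otimes> y \<otimes> z"
proof -
  have inner: "balanced (\<lambda>(x::'a) (y::'b). x \<otimes> y \<otimes> z)" for z :: 'c
    by (auto simp: balanced_def pure_tensor_add_left pure_tensor_add_right
        pure_tensor_scale_left pure_tensor_scale_right)
  have scale: "tensor_lift (\<lambda>x y. x \<otimes> y \<otimes> z) (c *\<^sub>C t)
      = c *\<^sub>C tensor_lift (\<lambda>(x::'a) (y::'b). x \<otimes> y \<otimes> z) t" for c t and z :: 'c
    by (rule tensor_lift_scale) (auto simp: inner pure_tensor_scale_left)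
  have "tensor_lift (\<lambda>x y. x \<otimes> y \<otimes> (z + z')) t
      = tensor_lift (\<lambda>x y. x \<otimes> y \<otimes> z) t + tensor_lift (\<lambda>(x::'a) (y::'b). x \<otimes> y \<otimes> z') t" for t and z z' :: 'c
    by (simp add: pure_tensor_add_right tensor_lift_fun_add)
  moreover have "tensor_lift (\<lambda>x y. x \<otimes> y \<otimes> (c *\<^sub>C z)) t
      = c *\<^sub>C tensor_lift (\<lambda>(x::'a) (y::'b). x \<otimes> y \<otimes> z) t" for c t and z :: 'c
    by (simp add: pure_tensor_scale_right tensor_lift_fun_scale)
  ultimately have "balanced (\<lambda>t (z::'c). tensor_lift (\<lambda>(x::'a) (y::'b). x \<otimes> y \<otimes> z) t)"
    unfolding balanced_def by (auto simp: inner tensor_lift_add scale)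
  then show ?thesis by (simp add: tensor_assoc_def tensor_lift_pure inner)
qed


section \<open>Real quantum groups\<close>

locale coalgebra =
  fixes \<Delta> :: "'c::complex_space \<Rightarrow> ('c, 'c) tensor" and \<epsilon> :: "'c \<Rightarrow> complex"
  assumes comult_linear: "clinear \<Delta>"
    and counit_linear: "cfunctional \<epsilon>"
    and coassoc: "tensor_assoc (tensor_map \<Delta> id (\<Delta> x)) = tensor_map id \<Delta> (\<Delta> x)"
    and counit_left: "tensor_lift (\<lambda>y z. \<epsilon> y *\<^sub>C z) (\<Delta> x) = x"
    and counit_right: "tensor_lift (\<lambda>y z. \<epsilon> z *\<^sub>C y) (\<Delta> x) = x"

locale hopf_algebra = coalgebra \<Delta> \<epsilon>
  for \<Delta> :: "'a::complex_alg \<Rightarrow> ('a, 'a) tensor" and \<epsilon> :: "'a \<Rightarrow> complex" +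
  fixes S :: "'a \<Rightarrow> 'a"
  assumes comult_mult: "\<Delta> (a * b) = tensor_mult (\<Delta> a) (\<Delta> b)"
    and comult_one: "\<Delta> 1 = 1 \<otimes> 1"
    and counit_mult: "\<epsilon> (a * b) = \<epsilon> a * \<epsilon> b"
    and counit_one: "\<epsilon> 1 = 1"
    and antipode_linear: "clinear S"
    and antipode_left: "tensor_lift (\<lambda>x y. S x * y) (\<Delta> a) = \<epsilon> a *\<^sub>C 1"
    and antipode_right: "tensor_lift (\<lambda>x y. x * S y) (\<Delta> a) = \<epsilon> a *\<^sub>C 1"

text \<open>The compatibility of the star with the counit and \<open>tau_tau\<close> are consequences of the other
  axioms; they are listed as in the usual definition of a Hopf *-algebra.\<close>

locale real_quantum_group = hopf_algebra \<Delta> \<epsilon> S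
  for \<Delta> :: "'a::complex_alg \<Rightarrow> ('a, 'a) tensor" and \<epsilon> :: "'a \<Rightarrow> complex" and S :: "'a \<Rightarrow> 'a" +
  fixes star :: "'a \<Rightarrow> 'a"
  assumes star_antilinear: "cantilinear star"
    and star_star: "star (star a) = a"
    and star_mult: "star (a * b) = star b * star a"
    and comult_star: "\<Delta> (star a) = tensor_map star star (\<Delta> a)"
    and counit_star: "\<epsilon> (star a) = cnj (\<epsilon> a)"
    and tau_tau: "star (S (star (S a))) = a"


section \<open>Real coisotropic quantum subgroups\<close>

definition left_module :: "('a::complex_alg \<Rightarrow> 'k::complex_space \<Rightarrow> 'k) \<Rightarrow> bool" where
  "left_module act \<longleftrightarrow> (\<forall>a. clinear (act a)) \<and> (\<forall>k. clinear (\<lambda>a. act a k)) \<and>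
     (\<forall>k. act 1 k = k) \<and> (\<forall>a b k. act (a * b) k = act a (act b k))"

definition right_module :: "('k::complex_space \<Rightarrow> 'a::complex_alg \<Rightarrow> 'k) \<Rightarrow> bool" where
  "right_module act \<longleftrightarrow> (\<forall>k. clinear (act k)) \<and> (\<forall>a. clinear (\<lambda>k. act k a)) \<and>
     (\<forall>k. act k 1 = k) \<and> (\<forall>a b k. act k (a * b) = act (act k a) b)"

locale real_coisotropic_subgroup =
  G: real_quantum_group \<Delta> \<epsilon> S star + K: coalgebra \<Delta>\<^sub>K \<epsilon>\<^sub>K
  for \<Delta> :: "'a::complex_alg \<Rightarrow> ('a, 'a) tensor" and \<epsilon> :: "'a \<Rightarrow> complex"
    and S :: "'a \<Rightarrow> 'a" and star :: "'a \<Rightarrow> 'a"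
    and \<Delta>\<^sub>K :: "'k::complex_space \<Rightarrow> ('k, 'k) tensor" and \<epsilon>\<^sub>K :: "'k \<Rightarrow> complex" +
  fixes \<pi> :: "'a \<Rightarrow> 'k" and \<tau>\<^sub>K :: "'k \<Rightarrow> 'k"
  assumes proj_linear: "clinear \<pi>"
    and proj_surj: "surj \<pi>"
    and proj_comult: "\<Delta>\<^sub>K (\<pi> a) = tensor_map \<pi> \<pi> (\<Delta> a)"
    and proj_counit: "\<epsilon>\<^sub>K (\<pi> a) = \<epsilon> a"
    and tauK_antilinear: "cantilinear \<tau>\<^sub>K"
    and tauK_proj: "\<tau>\<^sub>K (\<pi> a) = \<pi> (star (S a))"

locale real_coisotropic_left_subgroup =
  real_coisotropic_subgroup \<Delta> \<epsilon> S star \<Delta>\<^sub>K \<epsilon>\<^sub>K \<pi> \<tau>\<^sub>K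
  for \<Delta> :: "'a::complex_alg \<Rightarrow> ('a, 'a) tensor" and \<epsilon> S star
    and \<Delta>\<^sub>K :: "'k::complex_space \<Rightarrow> ('k, 'k) tensor" and \<epsilon>\<^sub>K \<pi> \<tau>\<^sub>K +
  fixes act :: "'a \<Rightarrow> 'k \<Rightarrow> 'k"
  assumes left_module: "left_module act"
    and proj_act: "\<pi> (a * b) = act a (\<pi> b)"

locale real_coisotropic_right_subgroup =
  real_coisotropic_subgroup \<Delta> \<epsilon> S star \<Delta>\<^sub>K \<epsilon>\<^sub>K \<pi> \<tau>\<^sub>K
  for \<Delta> :: "'a::complex_alg \<Rightarrow> ('a, 'a) tensor" and \<epsilon> S star
    and \<Delta>\<^sub>K :: "'k::complex_space \<Rightarrow> ('k, 'k) tensor" and \<epsilon>\<^sub>K \<pi> \<tau>\<^sub>K +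
  fixes act :: "'k \<Rightarrow> 'a \<Rightarrow> 'k"
  assumes right_module: "right_module act"
    and proj_act: "\<pi> (a * b) = act (\<pi> a) b"

definition L_map :: "('a::complex_space \<Rightarrow> ('a, 'a) tensor) \<Rightarrow> ('a \<Rightarrow> 'k::complex_space)
    \<Rightarrow> 'a \<Rightarrow> ('k, 'a) tensor" where
  "L_map \<Delta> \<pi> a = tensor_map \<pi> id (\<Delta> a)"

definition R_map :: "('a::complex_space \<Rightarrow> ('a, 'a) tensor) \<Rightarrow> ('a \<Rightarrow> 'k::complex_space)
    \<Rightarrow> 'a \<Rightarrow> ('a, 'k) tensor" where
  "R_map \<Delta> \<pi> a = tensor_map id \<pi> (\<Delta> a)"

text \<open>\<open>B_sub\<close> is $B_\pi$ (left subgroups), \<open>B_sup\<close> is $B^\pi$ (right subgroups).\<close>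

definition B_sub :: "('a::complex_alg \<Rightarrow> ('a, 'a) tensor) \<Rightarrow> ('a \<Rightarrow> 'k::complex_space) \<Rightarrow> 'a set" where
  "B_sub \<Delta> \<pi> = {a. L_map \<Delta> \<pi> a = \<pi> 1 \<otimes> a}"

definition B_sup :: "('a::complex_alg \<Rightarrow> ('a, 'a) tensor) \<Rightarrow> ('a \<Rightarrow> 'k::complex_space) \<Rightarrow> 'a set" where
  "B_sup \<Delta> \<pi> = {a. R_map \<Delta> \<pi> a = a \<otimes> \<pi> 1}"


section \<open>Unitary corepresentations and induction\<close>

definition scalar_product :: "('v::complex_space \<Rightarrow> 'v \<Rightarrow> complex) \<Rightarrow> bool" where
  "scalar_product ip \<longleftrightarrow> (\<forall>v. cfunctional (ip v)) \<and> (\<forall>v w. ip w v = cnj (ip v w)) \<and>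
     (\<forall>v. v \<noteq> 0 \<longrightarrow> ip v v \<in> \<real> \<and> Re (ip v v) > 0)"

text \<open>The basis is algebraic (every vector is a finite combination) but may be infinite.\<close>

definition orthonormal_basis ::
  "('v::complex_space \<Rightarrow> 'v \<Rightarrow> complex) \<Rightarrow> 'i set \<Rightarrow> ('i \<Rightarrow> 'v) \<Rightarrow> bool" where
  "orthonormal_basis ip I e \<longleftrightarrow>
     (\<forall>i\<in>I. \<forall>j\<in>I. ip (e i) (e j) = (if i = j then 1 else 0)) \<and>
     complex_space.span (e ` I) = UNIV"

locale right_corep = K: coalgebra \<Delta>\<^sub>K \<epsilon>\<^sub>K
  for \<Delta>\<^sub>K :: "'k::complex_space \<Rightarrow> ('k, 'k) tensor" and \<epsilon>\<^sub>K :: "'k \<Rightarrow> complex" +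
  fixes \<rho> :: "'v::complex_space \<Rightarrow> ('v, 'k) tensor"
  assumes corep_linear: "clinear \<rho>"
    and corep_comult: "tensor_assoc (tensor_map \<rho> id (\<rho> v)) = tensor_map id \<Delta>\<^sub>K (\<rho> v)"
    and corep_counit: "tensor_lift (\<lambda>w k. \<epsilon>\<^sub>K k *\<^sub>C w) (\<rho> v) = v"

locale left_corep = K: coalgebra \<Delta>\<^sub>K \<epsilon>\<^sub>K
  for \<Delta>\<^sub>K :: "'k::complex_space \<Rightarrow> ('k, 'k) tensor" and \<epsilon>\<^sub>K :: "'k \<Rightarrow> complex" +
  fixes \<rho> :: "'v::complex_space \<Rightarrow> ('k, 'v) tensor"
  assumes corep_linear: "clinear \<rho>"
    and corep_comult: "tensor_assoc (tensor_map \<Delta>\<^sub>K id (\<rho> v)) = tensor_map id \<rho> (\<rho> v)"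
    and corep_counit: "tensor_lift (\<lambda>k w. \<epsilon>\<^sub>K k *\<^sub>C w) (\<rho> v) = v"

text \<open>For a basis \<open>e\<close> the matrix coefficients exist and are unique (on \<open>I \<times> I\<close>), so that the
  existential quantifiers in the unitarity conditions below only name them.\<close>

definition right_coeffs :: "'i set \<Rightarrow> ('i \<Rightarrow> 'v::complex_space) \<Rightarrow>
    ('v \<Rightarrow> ('v, 'k::complex_space) tensor) \<Rightarrow> ('i \<Rightarrow> 'i \<Rightarrow> 'k) \<Rightarrow> bool" where
  "right_coeffs I e \<rho> a \<longleftrightarrow> (\<forall>i\<in>I. finite {j\<in>I. a j i \<noteq> 0} \<and>
     \<rho> (e i) = (\<Sum>j | j \<in> I \<and> a j i \<noteq> 0. e j \<otimes> a j i))"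

definition left_coeffs :: "'i set \<Rightarrow> ('i \<Rightarrow> 'v::complex_space) \<Rightarrow>
    ('v \<Rightarrow> ('k::complex_space, 'v) tensor) \<Rightarrow> ('i \<Rightarrow> 'i \<Rightarrow> 'k) \<Rightarrow> bool" where
  "left_coeffs I e \<rho> b \<longleftrightarrow> (\<forall>i\<in>I. finite {j\<in>I. b i j \<noteq> 0} \<and>
     \<rho> (e i) = (\<Sum>j | j \<in> I \<and> b i j \<noteq> 0. b i j \<otimes> e j))"

definition unitary_right :: "'i set \<Rightarrow> ('i \<Rightarrow> 'v::complex_space) \<Rightarrow>
    ('k::complex_space \<Rightarrow> 'k) \<Rightarrow> ('v \<Rightarrow> ('v, 'k) tensor) \<Rightarrow> bool" where
  "unitary_right I e \<tau>\<^sub>K \<rho> \<longleftrightarrow>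
     (\<exists>a. right_coeffs I e \<rho> a \<and> (\<forall>i\<in>I. \<forall>j\<in>I. \<tau>\<^sub>K (a i j) = a j i))"

definition unitary_left :: "'i set \<Rightarrow> ('i \<Rightarrow> 'v::complex_space) \<Rightarrow>
    ('k::complex_space \<Rightarrow> 'k) \<Rightarrow> ('v \<Rightarrow> ('k, 'v) tensor) \<Rightarrow> bool" where
  "unitary_left I e \<tau>\<^sub>K \<rho> \<longleftrightarrow>
     (\<exists>b. left_coeffs I e \<rho> b \<and> (\<forall>i\<in>I. \<forall>j\<in>I. \<tau>\<^sub>K (b i j) = b j i))"

definition ind_right :: "('a::complex_space \<Rightarrow> ('a, 'a) tensor) \<Rightarrow> ('a \<Rightarrow> 'k::complex_space) \<Rightarrow>
    ('v::complex_space \<Rightarrow> ('v, 'k) tensor) \<Rightarrow> ('v, 'a) tensor set" where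
  "ind_right \<Delta> \<pi> \<rho> = {F. tensor_map id (L_map \<Delta> \<pi>) F = tensor_assoc (tensor_map \<rho> id F)}"

definition ind_left :: "('a::complex_space \<Rightarrow> ('a, 'a) tensor) \<Rightarrow> ('a \<Rightarrow> 'k::complex_space) \<Rightarrow>
    ('v::complex_space \<Rightarrow> ('k, 'v) tensor) \<Rightarrow> ('a, 'v) tensor set" where
  "ind_left \<Delta> \<pi> \<rho> = {F. tensor_assoc (tensor_map (R_map \<Delta> \<pi>) id F) = tensor_map id \<rho> F}"

definition pairing_L :: "('v::complex_space \<Rightarrow> 'v \<Rightarrow> complex) \<Rightarrow> ('a::complex_alg \<Rightarrow> 'a) \<Rightarrow>
    ('v, 'a) tensor \<Rightarrow> ('v, 'a) tensor \<Rightarrow> 'a" where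
  "pairing_L ip star A B =
     tensor_lift (\<lambda>v a. tensor_lift (\<lambda>w b. ip v w *\<^sub>C (star a * b)) B) A"

definition pairing_R :: "('v::complex_space \<Rightarrow> 'v \<Rightarrow> complex) \<Rightarrow> ('a::complex_alg \<Rightarrow> 'a) \<Rightarrow>
    ('a, 'v) tensor \<Rightarrow> ('a, 'v) tensor \<Rightarrow> 'a" where
  "pairing_R ip star A B =
     tensor_lift (\<lambda>a v. tensor_lift (\<lambda>b w. ip v w *\<^sub>C (b * star a)) B) A"

lemma cfunctionalD:
  assumes "cfunctional f"
  shows "f (x + y) = f x + f y" "f (c *\<^sub>C x) = c * f x"
proof -
  show "f (x + y) = f x + f y" using assms by (rule linear_plus)
  show "f (c *\<^sub>C x) = c * f x" using assms by (rule linear_cscale)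
qed

lemma pairing_L_props:
  assumes ip: "scalar_product ip" and star: "cantilinear star"
  shows pairing_L_pure: "pairing_L ip star (v \<otimes> a) (w \<otimes> b) = ip v w *\<^sub>C (star a * b)"
    and pairing_L_linear: "clinear (pairing_L ip star A)"
    and pairing_L_antilinear: "cantilinear (\<lambda>A. pairing_L ip star A B)"
proof -
  have ip2: "ip v (w + w') = ip v w + ip v w'" "ip v (c *\<^sub>C w) = c * ip v w" for v w w' c
  proof -
    have "cfunctional (ip v)" using ip unfolding scalar_product_def by blast
    then show "ip v (w + w') = ip v w + ip v w'" "ip v (c *\<^sub>C w) = c * ip v w"
      by (rule cfunctionalD)+
  qed
  have sym: "ip w v = cnj (ip v w)" for v w
    using ip unfolding scalar_product_def by blast
  have ip1: "ip (w + w') v = ip w v + ip w' v" "ip (c *\<^sub>C w) v = cnj c * ip w v" for v w w' c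
    by (simp_all add: sym[of _ v] ip2)
  have star': "star (x + y) = star x + star y" "star (c *\<^sub>C x) = cnj c *\<^sub>C star x" for x y c
    using star by (auto simp: cantilinear_def)
  note rules = ip1 ip2 star' cscale_add_left cscale_add_right cscale_cscale
    cscale_mult_left cscale_mult_right distrib_left distrib_right
  let ?f = "\<lambda>v a w b. ip v w *\<^sub>C (star a * b)"
  have inner: "balanced (?f v a)" for v a
    by (auto simp: balanced_def rules mult.commute)
  have inner_add: "tensor_lift (?f (v + v') a) B = tensor_lift (?f v a) B + tensor_lift (?f v' a) B"
      "tensor_lift (?f v (a + a')) B = tensor_lift (?f v a) B + tensor_lift (?f v a') B"
      "tensor_lift (?f (c *\<^sub>C v) a) B = cnj c *\<^sub>C tensor_lift (?f v a) B"
      "tensor_lift (?f v (c *\<^sub>C a)) B = cnj c *\<^sub>C tensor_lift (?f v a) B" for v v' a a' c B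
    by (simp_all add: tensor_lift_fun_add[symmetric] tensor_lift_fun_scale[symmetric] rules
        mult.commute)
  have outer: "balanced (\<lambda>v a. tensor_lift (?f v a) B)" for B
    by (auto simp: balanced_def inner_add)
  show "pairing_L ip star (v \<otimes> a) (w \<otimes> b) = ip v w *\<^sub>C (star a * b)"
    unfolding pairing_L_def
    by (rule trans[OF tensor_lift_pure[OF outer] tensor_lift_pure[OF inner]])
  show "cantilinear (\<lambda>A. pairing_L ip star A B)"
    by (simp add: cantilinear_def pairing_L_def tensor_lift_add outer
        tensor_lift_scale[OF outer inner_add(3)])
  have lift_scale: "tensor_lift (?f v a) (c *\<^sub>C B) = c *\<^sub>C tensor_lift (?f v a) B" for v a c B
    by (rule tensor_lift_scale[OF inner]) (simp add: rules)
  have "pairing_L ip star A (B + B') = pairing_L ip star A B + pairing_L ip star A B'" for B B'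
    by (simp add: pairing_L_def tensor_lift_add inner tensor_lift_fun_add)
  moreover have "pairing_L ip star A (c *\<^sub>C B) = c *\<^sub>C pairing_L ip star A B" for c B
    by (simp add: pairing_L_def lift_scale tensor_lift_fun_scale)
  ultimately show "clinear (pairing_L ip star A)"
    by (rule clinearI)
qed

lemma pairing_R_props:
  assumes ip: "scalar_product ip" and star: "cantilinear star"
  shows pairing_R_pure: "pairing_R ip star (a \<otimes> v) (b \<otimes> w) = ip v w *\<^sub>C (b * star a)"
    and pairing_R_linear: "clinear (pairing_R ip star A)"
    and pairing_R_antilinear: "cantilinear (\<lambda>A. pairing_R ip star A B)"
proof -
  have ip2: "ip v (w + w') = ip v w + ip v w'" "ip v (c *\<^sub>C w) = c * ip v w" for v w w' c
  proof -
    have "cfunctional (ip v)" using ip unfolding scalar_product_def by blast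
    then show "ip v (w + w') = ip v w + ip v w'" "ip v (c *\<^sub>C w) = c * ip v w"
      by (rule cfunctionalD)+
  qed
  have sym: "ip w v = cnj (ip v w)" for v w
    using ip unfolding scalar_product_def by blast
  have ip1: "ip (w + w') v = ip w v + ip w' v" "ip (c *\<^sub>C w) v = cnj c * ip w v" for v w w' c
    by (simp_all add: sym[of _ v] ip2)
  have star': "star (x + y) = star x + star y" "star (c *\<^sub>C x) = cnj c *\<^sub>C star x" for x y c
    using star by (auto simp: cantilinear_def)
  note rules = ip1 ip2 star' cscale_add_left cscale_add_right cscale_cscale
    cscale_mult_left cscale_mult_right distrib_left distrib_right
  let ?f = "\<lambda>a v b w. ip v w *\<^sub>C (b * star a)"
  have inner: "balanced (?f a v)" for v a
    by (auto simp: balanced_def rules mult.commute)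
  have inner_add: "tensor_lift (?f a (v + v')) B = tensor_lift (?f a v) B + tensor_lift (?f a v') B"
      "tensor_lift (?f (a + a') v) B = tensor_lift (?f a v) B + tensor_lift (?f a' v) B"
      "tensor_lift (?f (c *\<^sub>C a) v) B = cnj c *\<^sub>C tensor_lift (?f a v) B"
      "tensor_lift (?f a (c *\<^sub>C v)) B = cnj c *\<^sub>C tensor_lift (?f a v) B" for v v' a a' c B
    by (simp_all add: tensor_lift_fun_add[symmetric] tensor_lift_fun_scale[symmetric] rules
        mult.commute)
  have outer: "balanced (\<lambda>a v. tensor_lift (?f a v) B)" for B
    by (auto simp: balanced_def inner_add)
  show "pairing_R ip star (a \<otimes> v) (b \<otimes> w) = ip v w *\<^sub>C (b * star a)"
    unfolding pairing_R_def
    by (rule trans[OF tensor_lift_pure[OF outer] tensor_lift_pure[OF inner]])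
  show "cantilinear (\<lambda>A. pairing_R ip star A B)"
    by (simp add: cantilinear_def pairing_R_def tensor_lift_add outer
        tensor_lift_scale[OF outer inner_add(3)])
  have lift_scale: "tensor_lift (?f a v) (c *\<^sub>C B) = c *\<^sub>C tensor_lift (?f a v) B" for v a c B
    by (rule tensor_lift_scale[OF inner]) (simp add: rules mult.commute)
  have "pairing_R ip star A (B + B') = pairing_R ip star A B + pairing_R ip star A B'" for B B'
    by (simp add: pairing_R_def tensor_lift_add inner tensor_lift_fun_add)
  moreover have "pairing_R ip star A (c *\<^sub>C B) = c *\<^sub>C pairing_R ip star A B" for c B
    by (simp add: pairing_R_def lift_scale tensor_lift_fun_scale)
  ultimately show "clinear (pairing_R ip star A)"
    by (rule clinearI)
qed

end

theory Submission
  imports Defs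
begin

text \<open>
  Let \<open>A = \<Sum>\<^sub>j e\<^sub>j \<otimes> A\<^sub>j\<close> and \<open>B = \<Sum>\<^sub>j e\<^sub>j \<otimes> B\<^sub>j\<close> be in the induced space, so that
  \<open>L A\<^sub>j = \<Sum>\<^sub>i a\<^sub>j\<^sub>i \<otimes> A\<^sub>i\<close> and likewise for \<open>B\<close>. Since \<open>\<pi>\<close> is a module map,
  \<open>L (\<Sum>\<^sub>j A\<^sub>j\<^sup>* B\<^sub>j) = \<Sum>\<^sub>i\<^sub>j (A\<^sub>j\<^bsub>(1)\<^esub>\<^sup>* \<cdot> a\<^sub>j\<^sub>i) \<otimes> A\<^sub>j\<^bsub>(2)\<^esub>\<^sup>* B\<^sub>i\<close>. By unitarity \<open>\<Sum>\<^sub>j a\<^sub>j\<^sub>i \<otimes> A\<^sub>j\<^sup>*\<close> is the image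
  \<open>\<pi> (S (A\<^sub>i\<^bsub>(1)\<^esub>)\<^sup>*) \<otimes> A\<^sub>i\<^bsub>(2)\<^esub>\<^sup>*\<close> of \<open>L A\<^sub>i\<close> under \<open>\<tau>\<^sub>K \<otimes> *\<close>, so the antipode axiom
  \<open>(S (x\<^bsub>(1)\<^esub>) x\<^bsub>(2)\<^esub>)\<^sup>* = \<epsilon> (x)\<^sup>* 1\<close> collapses the sum to \<open>\<pi> 1 \<otimes> \<Sum>\<^sub>i A\<^sub>i\<^sup>* B\<^sub>i\<close>.
  The right-handed statement is the mirror image.
\<close>

section \<open>Additive and balanced maps on tensor products\<close>

lemmas pure_tensor_simps = pure_tensor_add_left pure_tensor_add_right
  pure_tensor_scale_left pure_tensor_scale_right

lemmas cscale_simps = cscale_add_left cscale_add_right cscale_cscale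
  cscale_mult_left cscale_mult_right

lemma cantilinearD:
  assumes "cantilinear f"
  shows "f (x + y) = f x + f y" "f (c *\<^sub>C x) = cnj c *\<^sub>C f x"
  using assms by (auto simp: cantilinear_def)

lemma clinear_id: "clinear id"
  by (rule clinearI) simp_all

lemma additive_clinear: "clinear f \<Longrightarrow> additive f"
  by (simp add: additive_def linear_plus)

lemma additive_cantilinear: "cantilinear f \<Longrightarrow> additive f"
  by (simp add: additive_def cantilinear_def)

lemma additive_comp: "additive f \<Longrightarrow> additive g \<Longrightarrow> additive (\<lambda>x. f (g x))"
  by (simp add: additive_def)

lemma additive_tensor_lift: "balanced f \<Longrightarrow> additive (tensor_lift f)"
  by (simp add: additive_def tensor_lift_add)

text \<open>A scalar can be absorbed into the left factor, so sums of pure tensors already exhaust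
  the tensor product and additivity is enough. Linear and antilinear maps are thus compared by one
  and the same rule.\<close>

lemma tensor_ext:
  assumes "additive f" "additive g" "\<And>x y. f (x \<otimes> y) = g (x \<otimes> y)"
  shows "f t = g t"
  by (induction t rule: tensor_induct)
    (simp_all add: assms additive.zero[OF assms(1)] additive.zero[OF assms(2)]
      additive.add[OF assms(1)] additive.add[OF assms(2)])

lemma balanced_tensor_map:
  assumes "clinear f \<and> clinear g \<or> cantilinear f \<and> cantilinear g"
  shows "balanced (\<lambda>x y. f x \<otimes> g y)"
  using assms by (auto simp: balanced_def cantilinear_def linear_plus linear_cscale pure_tensor_simps)

lemma additive_tensor_map:
  assumes "clinear f \<and> clinear g \<or> cantilinear f \<and> cantilinear g"
  shows "additive (tensor_map f g)"
  unfolding tensor_map_def by (intro additive_tensor_lift balanced_tensor_map assms)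

lemma clinear_tensor_map:
  assumes "clinear f" "clinear g"
  shows "clinear (tensor_map f g)"
proof (rule clinearI)
  note b = balanced_tensor_map[OF disjI1, OF conjI, OF assms]
  show "tensor_map f g (s + t) = tensor_map f g s + tensor_map f g t" for s t
    by (simp add: tensor_map_def tensor_lift_add[OF b])
  show "tensor_map f g (c *\<^sub>C t) = c *\<^sub>C tensor_map f g t" for c t
    by (simp add: tensor_map_def tensor_lift_scale[OF b] linear_cscale[OF assms(1)] pure_tensor_simps)
qed

lemma clinear_comp: "clinear f \<Longrightarrow> clinear g \<Longrightarrow> clinear (\<lambda>x. f (g x))"
  by (rule clinearI) (simp_all add: linear_plus linear_cscale)

lemma clinear_comp_cantilinear: "clinear f \<Longrightarrow> cantilinear g \<Longrightarrow> cantilinear (\<lambda>x. f (g x))"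
  by (simp add: cantilinear_def linear_plus linear_cscale)

text \<open>Contracting one leg with a functional. With \<open>ip (e j)\<close> this extracts a
  component along the basis; with \<open>\<epsilon>\<close> it is the map in the counit
  axiom.\<close>

lemma balanced_scalar_left: "cfunctional h \<Longrightarrow> balanced (\<lambda>v x. h v *\<^sub>C x)"
  by (simp add: balanced_def cfunctionalD cscale_simps mult.commute)

lemma balanced_scalar_right: "cfunctional h \<Longrightarrow> balanced (\<lambda>x v. h v *\<^sub>C x)"
  by (simp add: balanced_def cfunctionalD cscale_simps mult.commute)

lemma additive_tensor_assoc: "additive (tensor_assoc ::
    (('a::complex_space, 'b::complex_space) tensor, 'c::complex_space) tensor \<Rightarrow> _)"
proof -
  have inner: "balanced (\<lambda>(x::'a) (y::'b). x \<otimes> y \<otimes> (z::'c))" for z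
    by (simp add: balanced_def pure_tensor_simps)
  have "balanced (\<lambda>t (z::'c). tensor_lift (\<lambda>(x::'a) (y::'b). x \<otimes> y \<otimes> z) t)"
    by (simp add: balanced_def tensor_lift_add[OF inner] tensor_lift_fun_add pure_tensor_simps
        tensor_lift_scale[OF inner] tensor_lift_fun_scale)
  then show ?thesis
    unfolding tensor_assoc_def by (rule additive_tensor_lift)
qed

lemma additive_pure_tensor_left: "additive (\<lambda>x. x \<otimes> y)"
  by (simp add: additive_def pure_tensor_simps)

lemma additive_pure_tensor_right: "additive (\<lambda>y. x \<otimes> y)"
  by (simp add: additive_def pure_tensor_simps)

lemmas pure_tensor_sum_left = additive.sum[OF additive_pure_tensor_left]
lemmas pure_tensor_sum_right = additive.sum[OF additive_pure_tensor_right]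
lemmas pure_tensor_zero_left = additive.zero[OF additive_pure_tensor_left]
lemmas pure_tensor_zero_right = additive.zero[OF additive_pure_tensor_right]

section \<open>Expansion of tensors along a basis\<close>

lemma span_image_finite_sum:
  assumes "v \<in> complex_space.span (e ` I)"
  shows "\<exists>J c. finite J \<and> J \<subseteq> I \<and> v = (\<Sum>j\<in>J. c j *\<^sub>C e j)"
proof -
  obtain T r where T: "finite T" "T \<subseteq> e ` I" "v = (\<Sum>w\<in>T. r w *\<^sub>C w)"
    using assms unfolding complex_space.span_explicit by blast
  \<comment> \<open>Choosing one index for each vector of \<open>T\<close> makes \<open>e\<close>
    injective on \<open>J\<close>, so the sum over vectors can be reindexed.\<close>
  obtain J where J: "J \<subseteq> I" "inj_on e J" "T = e ` J"
    using T(2) by (rule subset_image_inj[THEN iffD1, THEN exE]) blast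
  have "finite J" using T(1) J finite_imageD by blast
  moreover have "v = (\<Sum>j\<in>J. r (e j) *\<^sub>C e j)"
    by (simp add: T(3) J(3) sum.reindex[OF J(2)])
  ultimately show ?thesis using J(1) by (intro exI[of _ J] exI[of _ "\<lambda>j. r (e j)"]) simp
qed

lemma sum_restrict_support:
  assumes "finite J'" "J \<subseteq> J'" "\<And>j. h j 0 = 0"
  shows "(\<Sum>j\<in>J'. h j (if j \<in> J then f j else 0)) = (\<Sum>j\<in>J. h j (f j))"
  using assms by (intro sum.mono_neutral_cong_right) auto

text \<open>The coefficients are chosen so that the expansion holds over every finite index set
  containing \<open>J\<close>. Two tensors can then be expanded over one common index set.\<close>

lemma tensor_expand_left:
  fixes t :: "('v::complex_space, 'x::complex_space) tensor"
  assumes span: "complex_space.span (e ` I) = UNIV"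
  shows "\<exists>J f. finite J \<and> J \<subseteq> I \<and> (\<forall>J'. finite J' \<longrightarrow> J \<subseteq> J' \<longrightarrow> t = (\<Sum>j\<in>J'. e j \<otimes> f j))"
proof (induction t rule: tensor_induct)
  case zero
  show ?case
    by (intro exI[of _ "{}"] exI[of _ "\<lambda>_. 0"]) (simp add: pure_tensor_zero_right)
next
  case (add t v x)
  then obtain J f where J: "finite J" "J \<subseteq> I"
      "\<And>J'. finite J' \<Longrightarrow> J \<subseteq> J' \<Longrightarrow> t = (\<Sum>j\<in>J'. e j \<otimes> f j)"
    by blast
  obtain M c where M: "finite M" "M \<subseteq> I" "v = (\<Sum>j\<in>M. c j *\<^sub>C e j)"
    using span_image_finite_sum[of v e I] span by auto
  let ?g = "\<lambda>j. if j \<in> M then c j *\<^sub>C x else 0"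
  \<comment> \<open>Extending the coefficients by \<open>0\<close> outside \<open>M\<close> makes
    the sum independent of the larger set \<open>J'\<close>.\<close>
  have "v \<otimes> x = (\<Sum>j\<in>J'. e j \<otimes> ?g j)" if "finite J'" "M \<subseteq> J'" for J'
    using sum_restrict_support[OF that, of "\<lambda>j y. e j \<otimes> y" "\<lambda>j. c j *\<^sub>C x"]
    by (simp add: M(3) pure_tensor_sum_left pure_tensor_zero_right pure_tensor_simps)
  then have "t + v \<otimes> x = (\<Sum>j\<in>J'. e j \<otimes> (f j + ?g j))" if "finite J'" "J \<union> M \<subseteq> J'" for J'
    using J(3)[of J'] that by (simp add: pure_tensor_add_right sum.distrib)
  with J(1,2) M(1,2) show ?case
    by (intro exI[of _ "J \<union> M"] exI[of _ "\<lambda>j. f j + ?g j"]) auto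
qed

lemma tensor_expand_right:
  fixes t :: "('x::complex_space, 'v::complex_space) tensor"
  assumes span: "complex_space.span (e ` I) = UNIV"
  shows "\<exists>J f. finite J \<and> J \<subseteq> I \<and> (\<forall>J'. finite J' \<longrightarrow> J \<subseteq> J' \<longrightarrow> t = (\<Sum>j\<in>J'. f j \<otimes> e j))"
proof (induction t rule: tensor_induct)
  case zero
  show ?case
    by (intro exI[of _ "{}"] exI[of _ "\<lambda>_. 0"]) (simp add: pure_tensor_zero_left)
next
  case (add t x v)
  then obtain J f where J: "finite J" "J \<subseteq> I"
      "\<And>J'. finite J' \<Longrightarrow> J \<subseteq> J' \<Longrightarrow> t = (\<Sum>j\<in>J'. f j \<otimes> e j)"
    by blast
  obtain M c where M: "finite M" "M \<subseteq> I" "v = (\<Sum>j\<in>M. c j *\<^sub>C e j)"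
    using span_image_finite_sum[of v e I] span by auto
  let ?g = "\<lambda>j. if j \<in> M then c j *\<^sub>C x else 0"
  have "x \<otimes> v = (\<Sum>j\<in>J'. ?g j \<otimes> e j)" if "finite J'" "M \<subseteq> J'" for J'
    using sum_restrict_support[OF that, of "\<lambda>j y. y \<otimes> e j" "\<lambda>j. c j *\<^sub>C x"]
    by (simp add: M(3) pure_tensor_sum_right pure_tensor_zero_left pure_tensor_simps)
  then have "t + x \<otimes> v = (\<Sum>j\<in>J'. (f j + ?g j) \<otimes> e j)" if "finite J'" "J \<union> M \<subseteq> J'" for J'
    using J(3)[of J'] that by (simp add: pure_tensor_add_left sum.distrib)
  with J(1,2) M(1,2) show ?case
    by (intro exI[of _ "J \<union> M"] exI[of _ "\<lambda>j. f j + ?g j"]) auto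
qed

text \<open>By orthonormality, contraction with \<open>ip (e j)\<close> kills every summand except
  the one of index \<open>j\<close>. The value \<open>0\<close> for \<open>j\<close> outside
  \<open>J\<close> matters when \<open>J\<close> is the support of a column of matrix
  coefficients.\<close>

lemma tensor_lift_basis_component:
  assumes "orthonormal_basis ip I e" "scalar_product ip" "finite J" "J \<subseteq> I" "j \<in> I"
  shows "tensor_lift (\<lambda>v x. ip (e j) v *\<^sub>C x) (\<Sum>i\<in>J. e i \<otimes> f i) = (if j \<in> J then f j else 0)"
    and "tensor_lift (\<lambda>x v. ip (e j) v *\<^sub>C x) (\<Sum>i\<in>J. f i \<otimes> e i) = (if j \<in> J then f j else 0)"
proof -
  have h: "cfunctional (ip (e j))" using assms(2) by (simp add: scalar_product_def)
  have ip: "ip (e j) (e i) = (if i = j then 1 else 0)" if "i \<in> J" for i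
    using assms that by (auto simp: orthonormal_basis_def)
  have "(\<Sum>i\<in>J. ip (e j) (e i) *\<^sub>C f i) = (\<Sum>i\<in>J. if i = j then f i else 0)"
    by (rule sum.cong) (simp_all add: ip cscale_one)
  then have sum: "(\<Sum>i\<in>J. ip (e j) (e i) *\<^sub>C f i) = (if j \<in> J then f j else 0)"
    using assms(3) by simp
  show "tensor_lift (\<lambda>v x. ip (e j) v *\<^sub>C x) (\<Sum>i\<in>J. e i \<otimes> f i) = (if j \<in> J then f j else 0)"
    by (simp add: additive.sum[OF additive_tensor_lift] balanced_scalar_left h tensor_lift_pure sum)
  show "tensor_lift (\<lambda>x v. ip (e j) v *\<^sub>C x) (\<Sum>i\<in>J. f i \<otimes> e i) = (if j \<in> J then f j else 0)"
    by (simp add: additive.sum[OF additive_tensor_lift] balanced_scalar_right h tensor_lift_pure sum)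
qed

section \<open>The induction condition in coordinates\<close>

context real_coisotropic_subgroup
begin

lemma clinear_L_map: "clinear (L_map \<Delta> \<pi>)"
  using clinear_comp[OF clinear_tensor_map[OF proj_linear clinear_id] G.comult_linear]
  by (simp add: L_map_def[abs_def])

lemma clinear_R_map: "clinear (R_map \<Delta> \<pi>)"
  using clinear_comp[OF clinear_tensor_map[OF clinear_id proj_linear] G.comult_linear]
  by (simp add: R_map_def[abs_def])

lemma cantilinear_comult_star: "cantilinear (\<lambda>a. \<Delta> (star a))"
  by (rule clinear_comp_cantilinear[OF G.comult_linear G.star_antilinear])

lemma star_one: "star 1 = 1"
  by (metis G.star_star G.star_mult mult_1 mult_1_right)

text \<open>Expand both sides of the defining equation of the induced space along the basis and
  contract the first leg with \<open>ip (e j)\<close>.\<close>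

lemma ind_right_component:
  assumes basis: "orthonormal_basis ip I e" "scalar_product ip"
    and \<rho>: "clinear \<rho>" and coeffs: "right_coeffs I e \<rho> a"
    and J: "finite J" "J \<subseteq> I" "j \<in> J"
    and ind: "(\<Sum>i\<in>J. e i \<otimes> f i) \<in> ind_right \<Delta> \<pi> \<rho>"
  shows "L_map \<Delta> \<pi> (f j) = (\<Sum>i\<in>J. a j i \<otimes> f i)"
proof -
  let ?h = "\<lambda>v x. ip (e j) v *\<^sub>C x"
  let ?D = "\<lambda>i. {k \<in> I. a k i \<noteq> 0}"
  have "cfunctional (ip (e j))" using basis(2) by (simp add: scalar_product_def)
  then have add: "additive (tensor_lift ?h)"
    by (intro additive_tensor_lift balanced_scalar_left)
  have "tensor_map id (L_map \<Delta> \<pi>) (\<Sum>i\<in>J. e i \<otimes> f i) = (\<Sum>i\<in>J. e i \<otimes> L_map \<Delta> \<pi> (f i))"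
    by (simp add: additive.sum[OF additive_tensor_map] tensor_map_pure clinear_id clinear_L_map)
  moreover have "tensor_assoc (tensor_map \<rho> id (\<Sum>i\<in>J. e i \<otimes> f i))
      = (\<Sum>i\<in>J. \<Sum>k\<in>?D i. e k \<otimes> a k i \<otimes> f i)"
    using coeffs J(2)
    by (auto simp: additive.sum[OF additive_tensor_map] tensor_map_pure clinear_id \<rho>
        additive.sum[OF additive_tensor_assoc] right_coeffs_def pure_tensor_sum_left
        tensor_assoc_pure intro!: sum.cong)
  \<comment> \<open>The inner sum runs over the support of column \<open>i\<close>, which may leave
    \<open>J\<close>. Only the index \<open>j\<close> of \<open>J\<close> survives the contraction
    below, and if \<open>j\<close> is outside the support then \<open>a j i = 0\<close>, so the
    formula still holds.\<close>
  ultimately have "(\<Sum>i\<in>J. e i \<otimes> L_map \<Delta> \<pi> (f i)) = (\<Sum>i\<in>J. \<Sum>k\<in>?D i. e k \<otimes> a k i \<otimes> f i)"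
    using ind by (simp add: ind_right_def)
  then have "tensor_lift ?h (\<Sum>i\<in>J. e i \<otimes> L_map \<Delta> \<pi> (f i))
      = (\<Sum>i\<in>J. tensor_lift ?h (\<Sum>k\<in>?D i. e k \<otimes> a k i \<otimes> f i))"
    by (simp add: additive.sum[OF add])
  also have "\<dots> = (\<Sum>i\<in>J. a j i \<otimes> f i)"
  proof (rule sum.cong[OF refl])
    fix i assume "i \<in> J"
    then have "finite (?D i)" using coeffs J(2) by (auto simp: right_coeffs_def)
    then show "tensor_lift ?h (\<Sum>k\<in>?D i. e k \<otimes> a k i \<otimes> f i) = a j i \<otimes> f i"
      using J by (subst tensor_lift_basis_component[OF basis]) (auto simp: pure_tensor_zero_left)
  qed
  also have "tensor_lift ?h (\<Sum>i\<in>J. e i \<otimes> L_map \<Delta> \<pi> (f i)) = L_map \<Delta> \<pi> (f j)"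
    using J by (subst tensor_lift_basis_component[OF basis]) auto
  finally show ?thesis .
qed

text \<open>The basis vector is now the last of three legs, and \<open>tensor_assoc\<close> brackets
  to the right, so the contraction with \<open>ip (e j)\<close> has to be applied inside the second
  factor.\<close>

lemma ind_left_component:
  fixes ip :: "'v::complex_space \<Rightarrow> 'v \<Rightarrow> complex"
  assumes basis: "orthonormal_basis ip I e" "scalar_product ip"
    and \<rho>: "clinear \<rho>" and coeffs: "left_coeffs I e \<rho> b"
    and J: "finite J" "J \<subseteq> I" "j \<in> J"
    and ind: "(\<Sum>i\<in>J. f i \<otimes> e i) \<in> ind_left \<Delta> \<pi> \<rho>"
  shows "R_map \<Delta> \<pi> (f j) = (\<Sum>i\<in>J. f i \<otimes> b i j)"
proof -
  let ?h = "\<lambda>x v. ip (e j) v *\<^sub>C x"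
  let ?D = "\<lambda>i. {k \<in> I. b i k \<noteq> 0}"
  have h: "cfunctional (ip (e j))" using basis(2) by (simp add: scalar_product_def)
  have h_scale: "tensor_lift ?h (c *\<^sub>C t) = c *\<^sub>C tensor_lift ?h t"
    for c and t :: "('y::complex_space, 'v) tensor"
    by (rule tensor_lift_scale[OF balanced_scalar_right[OF h]]) (simp add: cscale_simps mult.commute)
  have bal: "balanced (\<lambda>x t. x \<otimes> tensor_lift ?h t)"
    by (simp add: balanced_def pure_tensor_simps tensor_lift_add[OF balanced_scalar_right[OF h]]
        h_scale)
  \<comment> \<open>the component map \<open>a \<otimes> (k \<otimes> v) \<mapsto> \<langle>e\<^sub>j, v\<rangle> (a \<otimes> k)\<close>\<close>
  let ?g = "tensor_lift (\<lambda>x t. x \<otimes> tensor_lift ?h t)"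
  note add = additive_tensor_lift[OF bal]
  \<comment> \<open>On a tensor bracketed to the left, reassociating and then contracting the last
    leg amounts to scaling by \<open>ip (e j) v\<close>.\<close>
  have g_assoc: "?g (tensor_assoc (s \<otimes> v)) = ip (e j) v *\<^sub>C s" for s v
    by (rule tensor_ext[OF additive_comp[OF add
            additive_comp[OF additive_tensor_assoc additive_pure_tensor_left]]])
      (simp_all add: additive_def cscale_simps tensor_assoc_pure tensor_lift_pure[OF bal]
        tensor_lift_pure[OF balanced_scalar_right[OF h]] pure_tensor_simps)
  have ip: "ip (e j) (e i) = (if i = j then 1 else 0)" if "i \<in> J" for i
    using basis(1) J that by (auto simp: orthonormal_basis_def subset_iff)
  have "?g (tensor_assoc (tensor_map (R_map \<Delta> \<pi>) id (\<Sum>i\<in>J. f i \<otimes> e i)))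
      = (\<Sum>i\<in>J. ip (e j) (e i) *\<^sub>C R_map \<Delta> \<pi> (f i))"
    by (simp add: additive.sum[OF additive_tensor_map] tensor_map_pure clinear_id clinear_R_map
        additive.sum[OF additive_tensor_assoc] additive.sum[OF add] g_assoc)
  also have "\<dots> = (\<Sum>i\<in>J. if i = j then R_map \<Delta> \<pi> (f i) else 0)"
    by (rule sum.cong) (simp_all add: ip cscale_one)
  also have "\<dots> = R_map \<Delta> \<pi> (f j)" using J by simp
  finally have lhs: "?g (tensor_assoc (tensor_map (R_map \<Delta> \<pi>) id (\<Sum>i\<in>J. f i \<otimes> e i)))
      = R_map \<Delta> \<pi> (f j)" .
  have "?g (tensor_map id \<rho> (\<Sum>i\<in>J. f i \<otimes> e i)) = (\<Sum>i\<in>J. f i \<otimes> tensor_lift ?h (\<rho> (e i)))"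
    by (simp add: additive.sum[OF additive_tensor_map] tensor_map_pure clinear_id \<rho>
        additive.sum[OF add] tensor_lift_pure[OF bal])
  also have "\<dots> = (\<Sum>i\<in>J. f i \<otimes> b i j)"
  proof (rule sum.cong[OF refl])
    fix i assume "i \<in> J"
    then have "finite (?D i)" "\<rho> (e i) = (\<Sum>k\<in>?D i. b i k \<otimes> e k)"
      using coeffs J(2) by (auto simp: left_coeffs_def)
    then show "f i \<otimes> tensor_lift ?h (\<rho> (e i)) = f i \<otimes> b i j"
      using J by (simp add: tensor_lift_basis_component(2)[OF basis] subset_iff)
  qed
  finally show ?thesis
    using ind lhs by (simp add: ind_left_def)
qed

end

section \<open>Left subgroups: the pairing of induced elements is coinvariant\<close>

context real_coisotropic_left_subgroup
begin

lemma act_simps: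
  "act (x + x') k = act x k + act x' k" "act x (k + k') = act x k + act x k'"
  "act (c *\<^sub>C x) k = c *\<^sub>C act x k" "act x (c *\<^sub>C k) = c *\<^sub>C act x k"
proof -
  have l: "clinear (act a)" "clinear (\<lambda>a. act a k)" for a k
    using left_module by (simp_all add: left_module_def)
  show "act (x + x') k = act x k + act x' k" using linear_plus[OF l(2)] .
  show "act (c *\<^sub>C x) k = c *\<^sub>C act x k" using linear_cscale[OF l(2)] .
  show "act x (k + k') = act x k + act x k'" using linear_plus[OF l(1)] .
  show "act x (c *\<^sub>C k) = c *\<^sub>C act x k" using linear_cscale[OF l(1)] .
qed

lemma balanced_act_mult: "balanced (\<lambda>x y. act x k \<otimes> (y * (b :: 'a)))"
  by (simp add: balanced_def act_simps pure_tensor_simps distrib_right cscale_simps)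

text \<open>The map is antilinear in \<open>k\<close> through \<open>\<tau>\<^sub>K\<close> and
  antilinear in \<open>y\<close> through \<open>star\<close>. A scalar therefore leaves either slot
  as the same conjugate, which is what \<open>balanced\<close> asks for.\<close>

lemma balanced_conj_act:
  "balanced (\<lambda>k y. tensor_lift (\<lambda>p q. act p (\<tau>\<^sub>K k) \<otimes> (q * (b :: 'a))) (\<Delta> (star y)))"
proof -
  have scale: "tensor_lift (\<lambda>p q. act p k \<otimes> (q * b)) (c *\<^sub>C t)
      = c *\<^sub>C tensor_lift (\<lambda>p q. act p k \<otimes> (q * b)) t" for k c t
    by (rule tensor_lift_scale[OF balanced_act_mult]) (simp add: act_simps pure_tensor_simps)
  show ?thesis
    by (simp add: balanced_def cantilinearD[OF tauK_antilinear] act_simps pure_tensor_simps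
        cantilinearD[OF cantilinear_comult_star] tensor_lift_fun_add tensor_lift_fun_scale
        tensor_lift_add[OF balanced_act_mult] scale)
qed

text \<open>The coproduct is multiplicative and \<open>\<pi>\<close> turns left multiplication into
  \<open>act\<close>. Hence L(ab) is the full coproduct of \<open>a\<close> acting on L(b), and only
  L(b) has to be known in coordinates.\<close>

lemma L_map_mult:
  assumes "L_map \<Delta> \<pi> b = (\<Sum>i\<in>J. k i \<otimes> b' i)"
  shows "L_map \<Delta> \<pi> (a * b) = (\<Sum>i\<in>J. tensor_lift (\<lambda>x y. act x (k i) \<otimes> (y * b' i)) (\<Delta> a))"
proof -
  \<comment> \<open>\<open>?M s t\<close> is the componentwise action of \<open>s\<close> on
    \<open>t\<close>: the first leg of \<open>s\<close> acts by \<open>act\<close>, the second by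
    multiplication.\<close>
  let ?M = "\<lambda>s t. tensor_lift (\<lambda>x y. tensor_lift (\<lambda>k b. act x k \<otimes> (y * b)) t) s"
  have inner: "balanced (\<lambda>k b. act x k \<otimes> (y * (b :: 'a)))" for x y
    by (simp add: balanced_def act_simps pure_tensor_simps distrib_left cscale_simps)
  have outer: "balanced (\<lambda>x y. tensor_lift (\<lambda>k b. act x k \<otimes> (y * (b :: 'a))) t)" for t
    by (simp add: balanced_def act_simps pure_tensor_simps distrib_right cscale_simps
        tensor_lift_fun_add tensor_lift_fun_scale)
  have inner': "balanced (\<lambda>x' y'. (x * x') \<otimes> (y * y'))" for x y :: 'a
    by (simp add: balanced_def pure_tensor_simps distrib_left cscale_simps)
  have outer': "balanced (\<lambda>x y. tensor_lift (\<lambda>x' y'. (x * x') \<otimes> (y * y')) t)"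
    for t :: "('a, 'a) tensor"
    by (simp add: balanced_def pure_tensor_simps distrib_right cscale_simps
        tensor_lift_fun_add tensor_lift_fun_scale)
  have pi: "clinear \<pi> \<and> clinear id \<or> cantilinear \<pi> \<and> cantilinear id"
    by (simp add: proj_linear clinear_id)
  \<comment> \<open>With \<open>s\<close> pure, additivity in \<open>t\<close> reduces the claim to
    \<open>proj_act\<close>; afterwards additivity in \<open>s\<close> gives the general
    case.\<close>
  have pure: "tensor_map \<pi> id (tensor_mult (x \<otimes> y) t) = ?M (x \<otimes> y) (tensor_map \<pi> id t)"
    for x y :: 'a and t
    unfolding tensor_mult_def tensor_lift_pure[OF outer'] tensor_lift_pure[OF outer]
    by (rule tensor_ext[OF additive_comp[OF additive_tensor_map[OF pi] additive_tensor_lift[OF inner']]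
            additive_comp[OF additive_tensor_lift[OF inner] additive_tensor_map[OF pi]]])
      (simp add: tensor_map_pure[OF pi] tensor_lift_pure[OF inner] tensor_lift_pure[OF inner'] proj_act)
  have eq: "tensor_map \<pi> id (tensor_mult s t) = ?M s (tensor_map \<pi> id t)"
    for s :: "('a, 'a) tensor" and t
    unfolding tensor_mult_def
    by (rule tensor_ext[OF additive_comp[OF additive_tensor_map[OF pi] additive_tensor_lift[OF outer']]
            additive_tensor_lift[OF outer] pure[unfolded tensor_mult_def]])
  have add: "additive (?M s)" for s :: "('a, 'a) tensor"
    by (simp add: additive_def tensor_lift_add[OF inner] tensor_lift_fun_add)
  show ?thesis
    using assms
    by (simp add: L_map_def G.comult_mult eq additive.sum[OF add] tensor_lift_pure[OF inner])
qed

text \<open>On \<open>\<pi> x\<close> the map \<open>\<tau>\<^sub>K\<close> is \<pi>(star (S x)),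
  and letting star y act on it gives \<pi>(star (S x * y)). By coassociativity x and y become the
  two legs of one coproduct, so the antipode axiom leaves \<pi>(1) times a conjugated counit, which
  the remaining leg absorbs.\<close>

lemma L_map_antipode_cancel:
  "tensor_lift (\<lambda>k y. tensor_lift (\<lambda>p q. act p (\<tau>\<^sub>K k) \<otimes> (q * b)) (\<Delta> (star y))) (L_map \<Delta> \<pi> a)
    = \<pi> 1 \<otimes> (star a * b)"
proof -
  note anti = cantilinearD[OF G.star_antilinear] cantilinearD[OF tauK_antilinear]
    linear_plus[OF proj_linear] linear_cscale[OF proj_linear]
    linear_plus[OF G.antipode_linear] linear_cscale[OF G.antipode_linear]
    linear_plus[OF G.comult_linear] linear_cscale[OF G.comult_linear]
  let ?n = "\<lambda>k y. tensor_lift (\<lambda>p q. act p (\<tau>\<^sub>K k) \<otimes> (q * b)) (\<Delta> (star y))"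
  let ?N = "tensor_lift ?n"
  \<comment> \<open>The three arguments stand for the three legs of the iterated coproduct of
    \<open>a\<close>; the antipode falls on the first.\<close>
  let ?g = "\<lambda>x p q. \<pi> (star (S x * p)) \<otimes> (star q * b)"
  let ?G = "tensor_lift (\<lambda>x. tensor_lift (?g x))"
  let ?m = "tensor_lift (\<lambda>x y. S x * y)"
  have pi: "clinear \<pi> \<and> clinear id \<or> cantilinear \<pi> \<and> cantilinear id"
    and dl: "clinear \<Delta> \<and> clinear id \<or> cantilinear \<Delta> \<and> cantilinear id"
    and dr: "clinear id \<and> clinear \<Delta> \<or> cantilinear id \<and> cantilinear \<Delta>"
    and st: "clinear star \<and> clinear star \<or> cantilinear star \<and> cantilinear star"
    by (simp_all add: proj_linear clinear_id G.comult_linear G.star_antilinear)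
  note n = balanced_conj_act[of b]
  have g: "balanced (?g x)" for x
    by (simp add: balanced_def anti pure_tensor_simps distrib_left distrib_right cscale_simps)
  have g_scale: "tensor_lift (?g x) (c *\<^sub>C t) = cnj c *\<^sub>C tensor_lift (?g x) t" for x c t
    by (rule tensor_lift_scale[OF g]) (simp add: anti pure_tensor_simps cscale_simps)
  have G: "balanced (\<lambda>x. tensor_lift (?g x))"
    by (simp add: balanced_def anti pure_tensor_simps distrib_left distrib_right cscale_simps
        tensor_lift_fun_add tensor_lift_fun_scale tensor_lift_add[OF g] g_scale)
  have n_pi: "?n (\<pi> x) y = tensor_lift (?g x) (\<Delta> y)" for x y
    unfolding G.comult_star
    by (rule tensor_ext[OF additive_comp[OF additive_tensor_lift[OF balanced_act_mult]
            additive_tensor_map[OF st]] additive_tensor_lift[OF g]])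
      (simp add: tensor_map_pure[OF st] tensor_lift_pure[OF balanced_act_mult] tensor_lift_pure[OF g],
        simp add: tauK_proj G.star_mult proj_act)
  \<comment> \<open>The coproduct hidden in \<open>?n\<close> is made explicit on the second leg, so
    that coassociativity applies.\<close>
  have N_L: "?N (tensor_map \<pi> id t) = ?G (tensor_map id \<Delta> t)" for t
    by (rule tensor_ext[OF additive_comp[OF additive_tensor_lift[OF n] additive_tensor_map[OF pi]]
            additive_comp[OF additive_tensor_lift[OF G] additive_tensor_map[OF dr]]])
      (simp add: tensor_map_pure[OF pi] tensor_map_pure[OF dr] tensor_lift_pure[OF n]
          tensor_lift_pure[OF G] n_pi)
  have m: "balanced (\<lambda>x y. S x * y)"
    by (simp add: balanced_def anti distrib_left distrib_right cscale_simps)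
  have G_assoc: "?G (tensor_assoc (t \<otimes> q)) = \<pi> (star (?m t)) \<otimes> (star q * b)" for t q
  proof (rule tensor_ext[where g = "\<lambda>t. \<pi> (star (?m t)) \<otimes> (star q * b)"])
    show "additive (\<lambda>t. ?G (tensor_assoc (t \<otimes> q)))"
      by (rule additive_comp[OF additive_tensor_lift[OF G]
            additive_comp[OF additive_tensor_assoc additive_pure_tensor_left]])
    show "additive (\<lambda>t. \<pi> (star (?m t)) \<otimes> (star q * b))"
      by (simp add: additive_def tensor_lift_add[OF m] anti pure_tensor_simps)
    show "?G (tensor_assoc ((x \<otimes> y) \<otimes> q)) = \<pi> (star (?m (x \<otimes> y))) \<otimes> (star q * b)" for x y
      by (simp add: tensor_lift_pure[OF m] tensor_assoc_pure tensor_lift_pure[OF G]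
          tensor_lift_pure[OF g])
  qed
  note eps = balanced_scalar_left[OF G.counit_linear]
  \<comment> \<open>The antipode axiom yields the scalar \<open>cnj (\<epsilon> x)\<close>. It moves
    across the tensor sign and reappears as the star of \<open>\<epsilon> x\<close> times
    \<open>y\<close>.\<close>
  have G_eps: "?G (tensor_assoc (tensor_map \<Delta> id t))
      = \<pi> 1 \<otimes> (star (tensor_lift (\<lambda>y z. \<epsilon> y *\<^sub>C z) t) * b)" for t
  proof (rule tensor_ext[where
        g = "\<lambda>t. \<pi> 1 \<otimes> (star (tensor_lift (\<lambda>y z. \<epsilon> y *\<^sub>C z) t) * b)"])
    show "additive (\<lambda>t. ?G (tensor_assoc (tensor_map \<Delta> id t)))"
      by (rule additive_comp[OF additive_tensor_lift[OF G]
            additive_comp[OF additive_tensor_assoc additive_tensor_map[OF dl]]])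
    show "additive (\<lambda>t. \<pi> 1 \<otimes> (star (tensor_lift (\<lambda>y z. \<epsilon> y *\<^sub>C z) t) * b))"
      by (simp add: additive_def tensor_lift_add[OF eps] anti distrib_right pure_tensor_simps)
    show "?G (tensor_assoc (tensor_map \<Delta> id (x \<otimes> y)))
        = \<pi> 1 \<otimes> (star (tensor_lift (\<lambda>y z. \<epsilon> y *\<^sub>C z) (x \<otimes> y)) * b)" for x y
      by (simp add: tensor_map_pure[OF dl] G_assoc G.antipode_left tensor_lift_pure[OF eps] anti
          cscale_simps star_one pure_tensor_simps)
  qed
  show ?thesis
    unfolding L_map_def N_L G.coassoc[symmetric] G_eps G.counit_left ..
qed

lemma pairing_L_in_B_sub:
  fixes ip :: "'v::complex_space \<Rightarrow> 'v \<Rightarrow> complex"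
  assumes basis: "orthonormal_basis ip I e" and ip: "scalar_product ip"
    and \<rho>: "clinear \<rho>" and unitary: "unitary_right I e \<tau>\<^sub>K \<rho>"
    and A: "A \<in> ind_right \<Delta> \<pi> \<rho>" and B: "B \<in> ind_right \<Delta> \<pi> \<rho>"
  shows "pairing_L ip star A B \<in> B_sub \<Delta> \<pi>"
proof -
  obtain a where coeffs: "right_coeffs I e \<rho> a"
    and tau: "\<And>i j. i \<in> I \<Longrightarrow> j \<in> I \<Longrightarrow> \<tau>\<^sub>K (a i j) = a j i"
    using unitary by (auto simp: unitary_right_def)
  have span: "complex_space.span (e ` I) = UNIV"
    using basis by (simp add: orthonormal_basis_def)
  obtain J1 f where J1: "finite J1" "J1 \<subseteq> I"
      "\<And>J'. finite J' \<Longrightarrow> J1 \<subseteq> J' \<Longrightarrow> A = (\<Sum>j\<in>J'. e j \<otimes> f j)"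
    using tensor_expand_left[OF span, of A] by blast
  obtain J2 g where J2: "finite J2" "J2 \<subseteq> I"
      "\<And>J'. finite J' \<Longrightarrow> J2 \<subseteq> J' \<Longrightarrow> B = (\<Sum>j\<in>J'. e j \<otimes> g j)"
    using tensor_expand_left[OF span, of B] by blast
  \<comment> \<open>A common index set lets the pairing of \<open>A\<close> and \<open>B\<close>
    collapse to its diagonal.\<close>
  define J where "J = J1 \<union> J2"
  have J: "finite J" "J \<subseteq> I" using J1 J2 by (auto simp: J_def)
  have AJ: "A = (\<Sum>j\<in>J. e j \<otimes> f j)" and BJ: "B = (\<Sum>j\<in>J. e j \<otimes> g j)"
    using J J1(3)[of J] J2(3)[of J] by (simp_all add: J_def)
  note comp = ind_right_component[OF basis ip \<rho> coeffs J]
  have Lf: "L_map \<Delta> \<pi> (f j) = (\<Sum>i\<in>J. a j i \<otimes> f i)" if "j \<in> J" for j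
    using comp[OF that] A AJ by simp
  have Lg: "L_map \<Delta> \<pi> (g j) = (\<Sum>i\<in>J. a j i \<otimes> g i)" if "j \<in> J" for j
    using comp[OF that] B BJ by simp
  have ortho: "ip (e j) (e i) = (if j = i then 1 else 0)" if "i \<in> J" "j \<in> J" for i j
    using basis J that by (simp add: orthonormal_basis_def subset_iff)
  note star = G.star_antilinear
  have "pairing_L ip star A B
      = (\<Sum>j\<in>J. \<Sum>i\<in>J. pairing_L ip star (e j \<otimes> f j) (e i \<otimes> g i))"
    unfolding AJ BJ
    additive.sum[OF additive_cantilinear[OF pairing_L_antilinear[OF ip star]]]
    additive.sum[OF additive_clinear[OF pairing_L_linear[OF ip star]]]
    by (rule sum.swap)
  also have "\<dots> = (\<Sum>j\<in>J. \<Sum>i\<in>J. if j = i then star (f j) * g i else 0)"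
    by (intro sum.cong) (simp_all add: pairing_L_pure[OF ip star] ortho cscale_one)
  also have "\<dots> = (\<Sum>j\<in>J. star (f j) * g j)"
    using J(1) by simp
  finally have pair: "pairing_L ip star A B = (\<Sum>j\<in>J. star (f j) * g j)" .
  let ?n = "\<lambda>b k y. tensor_lift (\<lambda>p q. act p (\<tau>\<^sub>K k) \<otimes> (q * b)) (\<Delta> (star y))"
  note n = balanced_conj_act
  have "L_map \<Delta> \<pi> (pairing_L ip star A B)
      = (\<Sum>j\<in>J. \<Sum>i\<in>J. tensor_lift (\<lambda>x y. act x (a j i) \<otimes> (y * g i)) (\<Delta> (star (f j))))"
    unfolding pair additive.sum[OF additive_clinear[OF clinear_L_map]]
    by (intro sum.cong refl L_map_mult Lg)
  \<comment> \<open>With \<open>i\<close> outside, the inner sum involves the single right factor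
    \<open>g i\<close> and all of column \<open>i\<close> of the coefficients.\<close>
  also have "\<dots> = (\<Sum>i\<in>J. \<Sum>j\<in>J. tensor_lift (\<lambda>x y. act x (a j i) \<otimes> (y * g i)) (\<Delta> (star (f j))))"
    by (rule sum.swap)
  also have "\<dots> = (\<Sum>i\<in>J. tensor_lift (?n (g i)) (L_map \<Delta> \<pi> (f i)))"
  proof (rule sum.cong[OF refl])
    fix i assume i: "i \<in> J"
    show "(\<Sum>j\<in>J. tensor_lift (\<lambda>x y. act x (a j i) \<otimes> (y * g i)) (\<Delta> (star (f j))))
        = tensor_lift (?n (g i)) (L_map \<Delta> \<pi> (f i))"
      \<comment> \<open>Unitarity enters here: \<open>a j i\<close> equals
        \<open>\<tau>\<^sub>K (a i j)\<close>, so the sum over \<open>j\<close> is the conjugating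
        map applied to the expansion of L at \<open>f i\<close>.\<close>
      unfolding Lf[OF i] additive.sum[OF additive_tensor_lift[OF n]]
      using i J(2) by (intro sum.cong) (auto simp: tensor_lift_pure[OF n] tau subset_iff)
  qed
  also have "\<dots> = \<pi> 1 \<otimes> pairing_L ip star A B"
    by (simp add: L_map_antipode_cancel pair pure_tensor_sum_right)
  finally show ?thesis by (simp add: B_sub_def)
qed

end

section \<open>Right subgroups: the mirrored argument\<close>

context real_coisotropic_right_subgroup
begin

lemma act_simps:
  "act (k + k') x = act k x + act k' x" "act k (x + x') = act k x + act k x'"
  "act (c *\<^sub>C k) x = c *\<^sub>C act k x" "act k (c *\<^sub>C x) = c *\<^sub>C act k x"
proof -
  have l: "clinear (act k)" "clinear (\<lambda>k. act k x)" for k x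
    using right_module by (simp_all add: right_module_def)
  show "act (k + k') x = act k x + act k' x" using linear_plus[OF l(2)] .
  show "act (c *\<^sub>C k) x = c *\<^sub>C act k x" using linear_cscale[OF l(2)] .
  show "act k (x + x') = act k x + act k x'" using linear_plus[OF l(1)] .
  show "act k (c *\<^sub>C x) = c *\<^sub>C act k x" using linear_cscale[OF l(1)] .
qed

lemma balanced_mult_act: "balanced (\<lambda>x y. ((b :: 'a) * x) \<otimes> act k y)"
  by (simp add: balanced_def act_simps pure_tensor_simps distrib_left cscale_simps)

lemma balanced_conj_act:
  "balanced (\<lambda>y k. tensor_lift (\<lambda>p q. ((b :: 'a) * p) \<otimes> act (\<tau>\<^sub>K k) q) (\<Delta> (star y)))"
proof -
  have scale: "tensor_lift (\<lambda>p q. (b * p) \<otimes> act k q) (c *\<^sub>C t)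
      = c *\<^sub>C tensor_lift (\<lambda>p q. (b * p) \<otimes> act k q) t" for k c t
    by (rule tensor_lift_scale[OF balanced_mult_act]) (simp add: cscale_simps pure_tensor_simps)
  show ?thesis
    by (simp add: balanced_def cantilinearD[OF tauK_antilinear] act_simps pure_tensor_simps
        cantilinearD[OF cantilinear_comult_star] tensor_lift_fun_add tensor_lift_fun_scale
        tensor_lift_add[OF balanced_mult_act] scale)
qed

text \<open>Now \<open>\<pi>\<close> turns right multiplication into \<open>act\<close>, so it is
  the left factor whose R-image is needed in coordinates. This fits the order in
  \<open>pairing_R\<close>, where the starred element stands on the right.\<close>

lemma R_map_mult:
  assumes "R_map \<Delta> \<pi> a = (\<Sum>i\<in>J. a' i \<otimes> k i)"
  shows "R_map \<Delta> \<pi> (a * b) = (\<Sum>i\<in>J. tensor_lift (\<lambda>x y. (a' i * x) \<otimes> act (k i) y) (\<Delta> b))"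
proof -
  let ?M = "\<lambda>s t. tensor_lift (\<lambda>x k. tensor_lift (\<lambda>x' y'. (x * x') \<otimes> act k y') t) s"
  have outer: "balanced (\<lambda>x k. tensor_lift (\<lambda>x' y'. ((x :: 'a) * x') \<otimes> act k y') t)" for t
    by (simp add: balanced_def act_simps pure_tensor_simps distrib_right cscale_simps
        tensor_lift_fun_add tensor_lift_fun_scale)
  have inner': "balanced (\<lambda>x' y'. (x * x') \<otimes> (y * y'))" for x y :: 'a
    by (simp add: balanced_def pure_tensor_simps distrib_left cscale_simps)
  have outer': "balanced (\<lambda>x y. tensor_lift (\<lambda>x' y'. (x * x') \<otimes> (y * y')) t)"
    for t :: "('a, 'a) tensor"
    by (simp add: balanced_def pure_tensor_simps distrib_right cscale_simps
        tensor_lift_fun_add tensor_lift_fun_scale)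
  have pi: "clinear id \<and> clinear \<pi> \<or> cantilinear id \<and> cantilinear \<pi>"
    by (simp add: proj_linear clinear_id)
  have pure: "tensor_map id \<pi> (tensor_mult (x \<otimes> y) t) = ?M (tensor_map id \<pi> (x \<otimes> y)) t"
    for x y :: 'a and t
    unfolding tensor_mult_def tensor_lift_pure[OF outer'] tensor_map_pure[OF pi]
      tensor_lift_pure[OF outer]
    by (rule tensor_ext[OF additive_comp[OF additive_tensor_map[OF pi] additive_tensor_lift[OF inner']]
            additive_tensor_lift[OF balanced_mult_act]])
      (simp add: tensor_map_pure[OF pi] tensor_lift_pure[OF balanced_mult_act]
        tensor_lift_pure[OF inner'] proj_act)
  have eq: "tensor_map id \<pi> (tensor_mult s t) = ?M (tensor_map id \<pi> s) t"
    for s :: "('a, 'a) tensor" and t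
    unfolding tensor_mult_def
    by (rule tensor_ext[OF additive_comp[OF additive_tensor_map[OF pi] additive_tensor_lift[OF outer']]
            additive_comp[OF additive_tensor_lift[OF outer] additive_tensor_map[OF pi]]
            pure[unfolded tensor_mult_def]])
  show ?thesis
    using assms
    by (simp add: R_map_def G.comult_mult eq additive.sum[OF additive_tensor_lift[OF outer]]
        tensor_lift_pure[OF outer])
qed

text \<open>Letting star q act on \<open>\<tau>\<^sub>K (\<pi> y)\<close> gives \<pi>(star (q * S
  y)), so the other antipode axiom is the relevant one, applied to the last two legs of the iterated
  coproduct.\<close>

lemma R_map_antipode_cancel:
  "tensor_lift (\<lambda>y k. tensor_lift (\<lambda>p q. (b * p) \<otimes> act (\<tau>\<^sub>K k) q) (\<Delta> (star y))) (R_map \<Delta> \<pi> a)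
    = (b * star a) \<otimes> \<pi> 1"
proof -
  note anti = cantilinearD[OF G.star_antilinear] cantilinearD[OF tauK_antilinear]
    linear_plus[OF proj_linear] linear_cscale[OF proj_linear]
    linear_plus[OF G.antipode_linear] linear_cscale[OF G.antipode_linear]
    linear_plus[OF G.comult_linear] linear_cscale[OF G.comult_linear]
  let ?n = "\<lambda>y k. tensor_lift (\<lambda>p q. (b * p) \<otimes> act (\<tau>\<^sub>K k) q) (\<Delta> (star y))"
  let ?N = "tensor_lift ?n"
  let ?g = "\<lambda>y p q. (b * star p) \<otimes> \<pi> (star (q * S y))"
  let ?G = "tensor_lift (\<lambda>t y. tensor_lift (?g y) t)"
  let ?m = "tensor_lift (\<lambda>x y. x * S y)"
  \<comment> \<open>\<open>?G\<close> reads triple tensors bracketed to the left, while the antipode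
    product needs the last two legs grouped together. \<open>?H\<close> is the same map on
    right-bracketed tensors, as \<open>G_H\<close> confirms.\<close>
  let ?H = "tensor_lift (\<lambda>p t. (b * star p) \<otimes> \<pi> (star (?m t)))"
  have pi: "clinear id \<and> clinear \<pi> \<or> cantilinear id \<and> cantilinear \<pi>"
    and dl: "clinear \<Delta> \<and> clinear id \<or> cantilinear \<Delta> \<and> cantilinear id"
    and dr: "clinear id \<and> clinear \<Delta> \<or> cantilinear id \<and> cantilinear \<Delta>"
    and st: "clinear star \<and> clinear star \<or> cantilinear star \<and> cantilinear star"
    by (simp_all add: proj_linear clinear_id G.comult_linear G.star_antilinear)
  note n = balanced_conj_act[of b]
  have g: "balanced (?g y)" for y
    by (simp add: balanced_def anti pure_tensor_simps distrib_left distrib_right cscale_simps)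
  have g_scale: "tensor_lift (?g y) (c *\<^sub>C t) = cnj c *\<^sub>C tensor_lift (?g y) t" for y c t
    by (rule tensor_lift_scale[OF g]) (simp add: anti pure_tensor_simps cscale_simps)
  have G: "balanced (\<lambda>t y. tensor_lift (?g y) t)"
    by (simp add: balanced_def anti pure_tensor_simps distrib_left distrib_right cscale_simps
        tensor_lift_fun_add tensor_lift_fun_scale tensor_lift_add[OF g] g_scale)
  have m: "balanced (\<lambda>x y. x * S y)"
    by (simp add: balanced_def anti distrib_left distrib_right cscale_simps)
  have m_scale: "?m (c *\<^sub>C t) = c *\<^sub>C ?m t" for c t
    by (rule tensor_lift_scale[OF m]) (simp add: cscale_simps)
  have H: "balanced (\<lambda>p t. (b * star p) \<otimes> \<pi> (star (?m t)))"
    by (simp add: balanced_def anti pure_tensor_simps distrib_left cscale_simps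
        tensor_lift_add[OF m] m_scale)
  have n_pi: "?n x (\<pi> y) = tensor_lift (?g y) (\<Delta> x)" for x y
    unfolding G.comult_star
    by (rule tensor_ext[OF additive_comp[OF additive_tensor_lift[OF balanced_mult_act]
            additive_tensor_map[OF st]] additive_tensor_lift[OF g]])
      (simp add: tensor_map_pure[OF st] tensor_lift_pure[OF balanced_mult_act] tensor_lift_pure[OF g],
        simp add: tauK_proj G.star_mult proj_act)
  have N_R: "?N (tensor_map id \<pi> t) = ?G (tensor_map \<Delta> id t)" for t
    by (rule tensor_ext[OF additive_comp[OF additive_tensor_lift[OF n] additive_tensor_map[OF pi]]
            additive_comp[OF additive_tensor_lift[OF G] additive_tensor_map[OF dl]]])
      (simp add: tensor_map_pure[OF pi] tensor_map_pure[OF dl] tensor_lift_pure[OF n]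
          tensor_lift_pure[OF G] n_pi)
  have g_H: "tensor_lift (?g y) t = ?H (tensor_assoc (t \<otimes> y))" for t y
    by (rule tensor_ext[OF additive_tensor_lift[OF g] additive_comp[OF additive_tensor_lift[OF H]
            additive_comp[OF additive_tensor_assoc additive_pure_tensor_left]]])
      (simp add: tensor_lift_pure[OF g] tensor_lift_pure[OF H] tensor_lift_pure[OF m]
        tensor_assoc_pure)
  have G_H: "?G u = ?H (tensor_assoc u)" for u
    by (rule tensor_ext[OF additive_tensor_lift[OF G]
          additive_comp[OF additive_tensor_lift[OF H] additive_tensor_assoc]
          trans[OF tensor_lift_pure[OF G] g_H]])
  note eps = balanced_scalar_right[OF G.counit_linear]
  \<comment> \<open>The conjugated counit now moves to the first leg, which matches the right counit
    axiom.\<close>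
  have H_eps: "?H (tensor_map id \<Delta> t)
      = (b * star (tensor_lift (\<lambda>y z. \<epsilon> z *\<^sub>C y) t)) \<otimes> \<pi> 1" for t
  proof (rule tensor_ext[where
        g = "\<lambda>t. (b * star (tensor_lift (\<lambda>y z. \<epsilon> z *\<^sub>C y) t)) \<otimes> \<pi> 1"])
    show "additive (\<lambda>t. ?H (tensor_map id \<Delta> t))"
      by (rule additive_comp[OF additive_tensor_lift[OF H] additive_tensor_map[OF dr]])
    show "additive (\<lambda>t. (b * star (tensor_lift (\<lambda>y z. \<epsilon> z *\<^sub>C y) t)) \<otimes> \<pi> 1)"
      by (simp add: additive_def tensor_lift_add[OF eps] anti distrib_left pure_tensor_simps)
    show "?H (tensor_map id \<Delta> (x \<otimes> y))
        = (b * star (tensor_lift (\<lambda>y z. \<epsilon> z *\<^sub>C y) (x \<otimes> y))) \<otimes> \<pi> 1" for x y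
      by (simp add: tensor_map_pure[OF dr] tensor_lift_pure[OF H] G.antipode_right
          tensor_lift_pure[OF eps] anti cscale_simps star_one pure_tensor_simps)
  qed
  show ?thesis
    unfolding R_map_def N_R G_H G.coassoc H_eps G.counit_right ..
qed

lemma pairing_R_in_B_sup:
  fixes ip :: "'v::complex_space \<Rightarrow> 'v \<Rightarrow> complex"
  assumes basis: "orthonormal_basis ip I e" and ip: "scalar_product ip"
    and \<rho>: "clinear \<rho>" and unitary: "unitary_left I e \<tau>\<^sub>K \<rho>"
    and A: "A \<in> ind_left \<Delta> \<pi> \<rho>" and B: "B \<in> ind_left \<Delta> \<pi> \<rho>"
  shows "pairing_R ip star A B \<in> B_sup \<Delta> \<pi>"
proof -
  obtain b where coeffs: "left_coeffs I e \<rho> b"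
    and tau: "\<And>i j. i \<in> I \<Longrightarrow> j \<in> I \<Longrightarrow> \<tau>\<^sub>K (b i j) = b j i"
    using unitary by (auto simp: unitary_left_def)
  have span: "complex_space.span (e ` I) = UNIV"
    using basis by (simp add: orthonormal_basis_def)
  obtain J1 f where J1: "finite J1" "J1 \<subseteq> I"
      "\<And>J'. finite J' \<Longrightarrow> J1 \<subseteq> J' \<Longrightarrow> A = (\<Sum>j\<in>J'. f j \<otimes> e j)"
    using tensor_expand_right[OF span, of A] by blast
  obtain J2 g where J2: "finite J2" "J2 \<subseteq> I"
      "\<And>J'. finite J' \<Longrightarrow> J2 \<subseteq> J' \<Longrightarrow> B = (\<Sum>j\<in>J'. g j \<otimes> e j)"
    using tensor_expand_right[OF span, of B] by blast
  define J where "J = J1 \<union> J2"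
  have J: "finite J" "J \<subseteq> I" using J1 J2 by (auto simp: J_def)
  have AJ: "A = (\<Sum>j\<in>J. f j \<otimes> e j)" and BJ: "B = (\<Sum>j\<in>J. g j \<otimes> e j)"
    using J J1(3)[of J] J2(3)[of J] by (simp_all add: J_def)
  note comp = ind_left_component[OF basis ip \<rho> coeffs J]
  have Rf: "R_map \<Delta> \<pi> (f j) = (\<Sum>i\<in>J. f i \<otimes> b i j)" if "j \<in> J" for j
    using comp[OF that] A AJ by simp
  have Rg: "R_map \<Delta> \<pi> (g j) = (\<Sum>i\<in>J. g i \<otimes> b i j)" if "j \<in> J" for j
    using comp[OF that] B BJ by simp
  have ortho: "ip (e j) (e i) = (if j = i then 1 else 0)" if "i \<in> J" "j \<in> J" for i j
    using basis J that by (simp add: orthonormal_basis_def subset_iff)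
  note star = G.star_antilinear
  have "pairing_R ip star A B
      = (\<Sum>j\<in>J. \<Sum>i\<in>J. pairing_R ip star (f j \<otimes> e j) (g i \<otimes> e i))"
    unfolding AJ BJ
    additive.sum[OF additive_cantilinear[OF pairing_R_antilinear[OF ip star]]]
    additive.sum[OF additive_clinear[OF pairing_R_linear[OF ip star]]]
    by (rule sum.swap)
  also have "\<dots> = (\<Sum>j\<in>J. \<Sum>i\<in>J. if j = i then g i * star (f j) else 0)"
    by (intro sum.cong) (simp_all add: pairing_R_pure[OF ip star] ortho cscale_one)
  also have "\<dots> = (\<Sum>j\<in>J. g j * star (f j))"
    using J(1) by simp
  finally have pair: "pairing_R ip star A B = (\<Sum>j\<in>J. g j * star (f j))" .
  let ?n = "\<lambda>b y k. tensor_lift (\<lambda>p q. (b * p) \<otimes> act (\<tau>\<^sub>K k) q) (\<Delta> (star y))"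
  note n = balanced_conj_act
  have "R_map \<Delta> \<pi> (pairing_R ip star A B)
      = (\<Sum>j\<in>J. \<Sum>i\<in>J. tensor_lift (\<lambda>x y. (g i * x) \<otimes> act (b i j) y) (\<Delta> (star (f j))))"
    unfolding pair additive.sum[OF additive_clinear[OF clinear_R_map]]
    by (intro sum.cong refl R_map_mult Rg)
  also have "\<dots> = (\<Sum>i\<in>J. \<Sum>j\<in>J. tensor_lift (\<lambda>x y. (g i * x) \<otimes> act (b i j) y) (\<Delta> (star (f j))))"
    by (rule sum.swap)
  also have "\<dots> = (\<Sum>i\<in>J. tensor_lift (?n (g i)) (R_map \<Delta> \<pi> (f i)))"
  proof (rule sum.cong[OF refl])
    fix i assume i: "i \<in> J"
    show "(\<Sum>j\<in>J. tensor_lift (\<lambda>x y. (g i * x) \<otimes> act (b i j) y) (\<Delta> (star (f j))))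
        = tensor_lift (?n (g i)) (R_map \<Delta> \<pi> (f i))"
      \<comment> \<open>By unitarity \<open>b i j\<close> is \<open>\<tau>\<^sub>K (b j i)\<close>,
        and the \<open>b j i\<close> are the coefficients in the expansion of R at
        \<open>f i\<close>.\<close>
      unfolding Rf[OF i] additive.sum[OF additive_tensor_lift[OF n]]
      using i J(2) by (intro sum.cong) (auto simp: tensor_lift_pure[OF n] tau subset_iff)
  qed
  also have "\<dots> = pairing_R ip star A B \<otimes> \<pi> 1"
    by (simp add: R_map_antipode_cancel pair pure_tensor_sum_left)
  finally show ?thesis by (simp add: B_sup_def)
qed

end

theorem lemma4p3:
  fixes \<Delta> :: "'a::complex_alg \<Rightarrow> ('a, 'a) tensor" and \<epsilon> :: "'a \<Rightarrow> complex"
    and S :: "'a \<Rightarrow> 'a" and star :: "'a \<Rightarrow> 'a"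
    and ip :: "'v::complex_space \<Rightarrow> 'v \<Rightarrow> complex" and I :: "'i set" and e :: "'i \<Rightarrow> 'v"
  assumes "real_quantum_group \<Delta> \<epsilon> S star"
    and "scalar_product ip" and "orthonormal_basis ip I e"
  shows
    "(\<forall>(\<Delta>\<^sub>K :: 'k::complex_space \<Rightarrow> ('k, 'k) tensor) \<epsilon>\<^sub>K \<pi> \<tau>\<^sub>K act \<rho>\<^sub>R A B.
       real_coisotropic_left_subgroup \<Delta> \<epsilon> S star \<Delta>\<^sub>K \<epsilon>\<^sub>K \<pi> \<tau>\<^sub>K act \<longrightarrow>
       right_corep \<Delta>\<^sub>K \<epsilon>\<^sub>K \<rho>\<^sub>R \<longrightarrow> unitary_right I e \<tau>\<^sub>K \<rho>\<^sub>R \<longrightarrow>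
       A \<in> ind_right \<Delta> \<pi> \<rho>\<^sub>R \<longrightarrow> B \<in> ind_right \<Delta> \<pi> \<rho>\<^sub>R \<longrightarrow>
       pairing_L ip star A B \<in> B_sub \<Delta> \<pi>)
    \<and>
     (\<forall>(\<Delta>\<^sub>K :: 'k::complex_space \<Rightarrow> ('k, 'k) tensor) \<epsilon>\<^sub>K \<pi> \<tau>\<^sub>K act \<rho>\<^sub>L A B.
       real_coisotropic_right_subgroup \<Delta> \<epsilon> S star \<Delta>\<^sub>K \<epsilon>\<^sub>K \<pi> \<tau>\<^sub>K act \<longrightarrow>
       left_corep \<Delta>\<^sub>K \<epsilon>\<^sub>K \<rho>\<^sub>L \<longrightarrow> unitary_left I e \<tau>\<^sub>K \<rho>\<^sub>L \<longrightarrow>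
       A \<in> ind_left \<Delta> \<pi> \<rho>\<^sub>L \<longrightarrow> B \<in> ind_left \<Delta> \<pi> \<rho>\<^sub>L \<longrightarrow>
       pairing_R ip star A B \<in> B_sup \<Delta> \<pi>)"
proof (intro conjI allI impI, goal_cases)
  case 1
  show ?case
    by (rule real_coisotropic_left_subgroup.pairing_L_in_B_sub[OF 1(1) assms(3,2)
          right_corep.corep_linear[OF 1(2)] 1(3-5)])
next
  case 2
  show ?case
    by (rule real_coisotropic_right_subgroup.pairing_R_in_B_sup[OF 2(1) assms(3,2)
          left_corep.corep_linear[OF 2(2)] 2(3-5)])
qed

end
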